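(* Let $X$ be a separable Hilbert space and consider a boundary control system $\dot x(t)=\hat Ax(t)$, $x(0)=x_0$, $\hat Gx(t)=u(t)$, with associated operator $A$ and lifting operator $G$. Assume that $A$ is a Riesz-spectral operator which generates an exponentially stable analytic semigroup. Furthermore, assume that $\dim(U)<\infty$ and $\mathcal U:=L_\infty(\mathbb R_+,U)$. Then $B:=\hat AG-A_{-1}G$ is an $\infty$-admissible operator, and both the boundary control system and the system $\dot x=A_{-1}x+(\hat AG-A_{-1}G)u$ are ISS with the state space $X$ and the input space $\mathcal U$.
   Context: $\mathbb R_+=[0,\infty)$; $U$ is a Banach space. Boundary control system: $\hat A:D(\hat A)\subset X\to X$ and $\hat G:D(\hat G)\subset X\to U$ are linear with $D(\hat A)\subset D(\hat G)$, such that (i) $A:D(A)\to X$ with $D(A)=D(\hat A)\cap\ker(\hat G)$, $Ax=\hat Ax$, is the infinitesimal generator of a $C_0$-semigroup $T$ on $X$; (ii) there is $G\in L(U,X)$ (a lifting operator) such that for all $u\in U$ we have $Gu\in D(\hat A)$, $\hat AG\in L(U,X)$ and $\hat GGu=u$. A sequence $\{\phi_k\}_{k\in\mathbb N}$ in $X$ is a $2$-Riesz basis if it is a Schauder basis of $X$ and for certain constants $c_1,c_2>0$ and all $\{a_k\}\in\ell_2$ one has $c_1\sum_k|a_k|^2\le\|\sum_ka_k\phi_k\|_X^2\le c_2\sum_k|a_k|^2$. A linear closed operator $A:D(A)\subset X\to X$ with eigenvalues $\lambda_n$ and corresponding eigenvectors $\phi_n\in D(A)$, $n\in\mathbb N$,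 is a Riesz-spectral operator if $\{\phi_n:n\in\mathbb N\}$ is a $2$-Riesz basis and the closure of $\{\lambda_n:n\in\mathbb N\}$ is totally disconnected, i.e. no two points $\lambda,\mu\in\overline{\{\lambda_n\}}$ can be connected by a segment entirely lying in $\overline{\{\lambda_n\}}$. $X_{-1}$ is the completion of $X$ with respect to $\|x\|_{X_{-1}}:=\|(aI-A)^{-1}x\|_X$ for some $a$ in the resolvent set of $A$; $T_{-1}$ is the unique extension of $T$ to a strongly continuous semigroup on $X_{-1}$, with generator $A_{-1}$ extending $A$, $D(A_{-1})=X$. $B\in L(U,X_{-1})$ is $\infty$-admissible if there is $t>0$ with $\int_0^tT_{-1}(t-s)Bu(s)\,ds\in X$ for all $u\in L_\infty(\mathbb R_+,U)$. For both systems the (mild) solution map is $\phi(t,x,u)=T(t)x+\int_0^tT_{-1}(t-r)Bu(r)\,dr$. ISS means that $(X,\mathcal U,\phi)$ is a forward complete control system (in particular $\phi(t,x,u)\in X$ for all $t\ge 0$, $x\in X$, $u\in\mathcal U$, with $t\mapsto\phi(t,x,u)$ continuous in $X$, and $\phi$ satisfies $\phi(0,x,u)=x$, causality and the cocycle property $\phi(h,\phi(t,x,u),u(t+\cdot))=\phi(t+h,x,u)$), and there exist $\beta\in\mathcal{KL}$, $\gamma\in\mathcal K_\infty$ with $\|\phi(t,x,u)\|_X\le\beta(\|x\|_X,t)+\gamma(\|u\|_{\mathcal U})$ for all $x\in X$, $u\in\mathcal U$, $t\ge0$. Here $\mathcal K_\infty$ is the set of continuous, strictly increasing, unbounded $\gamma:\mathbb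 R_+\to\mathbb R_+$ with $\gamma(0)=0$; $\mathcal{KL}$ is the set of continuous $\beta:\mathbb R_+^2\to\mathbb R_+$ such that $\beta(\cdot,t)$ is strictly increasing with $\beta(0,t)=0$ for all $t\ge0$, and $\beta(r,\cdot)$ is strictly decreasing to $0$ for all $r>0$. *)

theory Defs
  imports "HOL-Analysis.Analysis" "HOL-Probability.Essential_Supremum"
begin

section \<open>Complex Banach and Hilbert spaces\<close>

class scaleC = scaleR +
  fixes scaleC :: "complex \<Rightarrow> 'a \<Rightarrow> 'a"
  assumes scaleR_scaleC: "scaleR r x = scaleC (complex_of_real r) x"

class complex_vector = scaleC + ab_group_add +
  assumes scaleC_add_right: "scaleC a (x + y) = scaleC a x + scaleC a y"
    and scaleC_add_left: "scaleC (a + b) x = scaleC a x + scaleC b x"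
    and scaleC_scaleC: "scaleC a (scaleC b x) = scaleC (a * b) x"
    and scaleC_one: "scaleC 1 x = x"

class complex_normed_vector = complex_vector + real_normed_vector +
  assumes norm_scaleC: "norm (scaleC a x) = cmod a * norm x"

class cbanach = complex_normed_vector + banach

text \<open>The inner product is antilinear in the first and linear in the second argument.\<close>

class complex_inner = complex_normed_vector +
  fixes cinner :: "'a \<Rightarrow> 'a \<Rightarrow> complex"
  assumes cinner_commute: "cinner x y = cnj (cinner y x)"
    and cinner_add_right: "cinner x (y + z) = cinner x y + cinner x z"
    and cinner_scaleC_right: "cinner x (scaleC a y) = a * cinner x y"
    and cinner_self_nonneg: "cinner x x \<in> \<real> \<and> 0 \<le> Re (cinner x x)"
    and cinner_eq_zero_iff: "cinner x x = 0 \<longleftrightarrow> x = 0"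
    and norm_eq_sqrt_cinner: "norm x = sqrt (Re (cinner x x))"

class chilbert_space = complex_inner + cbanach

lemma vector_space_scaleC:
  "vector_space (scaleC :: complex \<Rightarrow> 'a \<Rightarrow> 'a::complex_vector)"
  by (simp add: vector_space_def scaleC_add_right scaleC_add_left scaleC_scaleC scaleC_one)

definition finite_dim_space :: "'a::complex_vector itself \<Rightarrow> bool" where
  "finite_dim_space _ \<longleftrightarrow>
     (\<exists>Basis :: 'a set. finite_dimensional_vector_space scaleC Basis)"


section \<open>Bounded and unbounded linear operators\<close>

definition bounded_clinear :: "('a::complex_normed_vector \<Rightarrow> 'b::complex_normed_vector) \<Rightarrow> bool" where
  "bounded_clinear f \<longleftrightarrow>
     Vector_Spaces.linear scaleC scaleC f \<and> (\<exists>K. \<forall>x. norm (f x) \<le> K * norm x)"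

text \<open>
  An unbounded operator is a domain \<open>D\<close> together with a total function, of which only the
  values on \<open>D\<close> are relevant.
\<close>

definition clinear_on :: "'a::complex_vector set \<Rightarrow> ('a \<Rightarrow> 'b::complex_vector) \<Rightarrow> bool" where
  "clinear_on D f \<longleftrightarrow> module.subspace scaleC D \<and>
     (\<forall>x\<in>D. \<forall>y\<in>D. f (x + y) = f x + f y) \<and> (\<forall>c. \<forall>x\<in>D. f (scaleC c x) = scaleC c (f x))"

definition closed_operator ::
  "'a::complex_normed_vector set \<Rightarrow> ('a \<Rightarrow> 'b::complex_normed_vector) \<Rightarrow> bool" where
  "closed_operator D A \<longleftrightarrow> closed ((\<lambda>x. (x, A x)) ` D)"

definition resolvent ::
  "'a::complex_normed_vector set \<Rightarrow> ('a \<Rightarrow> 'a) \<Rightarrow> complex \<Rightarrow> 'a \<Rightarrow> 'a" where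
  "resolvent D A a = the_inv_into D (\<lambda>x. scaleC a x - A x)"

definition resolvent_set ::
  "'a::complex_normed_vector set \<Rightarrow> ('a \<Rightarrow> 'a) \<Rightarrow> complex set" where
  "resolvent_set D A =
     {a. bij_betw (\<lambda>x. scaleC a x - A x) D UNIV \<and> bounded_clinear (resolvent D A a)}"


section \<open>Strongly continuous semigroups\<close>

text \<open>A semigroup is a function of real time of which only the values at \<open>t \<ge> 0\<close> are relevant.\<close>

definition C0_semigroup :: "(real \<Rightarrow> 'a::cbanach \<Rightarrow> 'a) \<Rightarrow> bool" where
  "C0_semigroup T \<longleftrightarrow>
     (\<forall>t\<ge>0. bounded_clinear (T t)) \<and>
     T 0 = id \<and>
     (\<forall>s\<ge>0. \<forall>t\<ge>0. T (s + t) = T s \<circ> T t) \<and>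
     (\<forall>x. ((\<lambda>t. T t x) \<longlongrightarrow> x) (at_right 0))"

definition gen_dom :: "(real \<Rightarrow> 'a::cbanach \<Rightarrow> 'a) \<Rightarrow> 'a set" where
  "gen_dom T = {x. \<exists>y. ((\<lambda>h. (T h x - x) /\<^sub>R h) \<longlongrightarrow> y) (at_right 0)}"

definition gen :: "(real \<Rightarrow> 'a::cbanach \<Rightarrow> 'a) \<Rightarrow> 'a \<Rightarrow> 'a" where
  "gen T x = Lim (at_right 0) (\<lambda>h. (T h x - x) /\<^sub>R h)"

definition generates ::
  "'a::cbanach set \<Rightarrow> ('a \<Rightarrow> 'a) \<Rightarrow> (real \<Rightarrow> 'a \<Rightarrow> 'a) \<Rightarrow> bool" where
  "generates D A T \<longleftrightarrow> C0_semigroup T \<and> D = gen_dom T \<and> (\<forall>x\<in>D. A x = gen T x)"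

definition exponentially_stable :: "(real \<Rightarrow> 'a::cbanach \<Rightarrow> 'a) \<Rightarrow> bool" where
  "exponentially_stable T \<longleftrightarrow>
     (\<exists>M>0. \<exists>\<omega>>0. \<forall>t\<ge>0. onorm (T t) \<le> M * exp (- \<omega> * t))"

definition sector :: "real \<Rightarrow> complex set" where
  "sector \<delta> = {z. z \<noteq> 0 \<and> \<bar>Arg z\<bar> < \<delta>}"

text \<open>
  The semigroup extends to a sector as a family of bounded operators that is holomorphic with
  respect to the operator norm, satisfies the semigroup law, and is strongly continuous at \<open>0\<close>
  on every strictly smaller sector.
\<close>

definition analytic_semigroup :: "(real \<Rightarrow> 'a::cbanach \<Rightarrow> 'a) \<Rightarrow> bool" where
  "analytic_semigroup T \<longleftrightarrow> C0_semigroup T \<and>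
     (\<exists>\<delta> S. 0 < \<delta> \<and> \<delta> \<le> pi / 2 \<and>
        (\<forall>t\<ge>0. S (complex_of_real t) = T t) \<and>
        (\<forall>z\<in>sector \<delta>. bounded_clinear (S z)) \<and>
        (\<forall>z\<in>sector \<delta>. \<forall>w\<in>sector \<delta>. S (z + w) = S z \<circ> S w) \<and>
        (\<forall>z\<in>sector \<delta>. \<exists>L. bounded_clinear L \<and>
           ((\<lambda>h. onorm (\<lambda>x. scaleC (inverse h) (S (z + h) x - S z x) - L x)) \<longlongrightarrow> 0) (at 0)) \<and>
        (\<forall>\<delta>'. 0 < \<delta>' \<and> \<delta>' < \<delta> \<longrightarrow>
           (\<forall>x. ((\<lambda>z. S z x) \<longlongrightarrow> x) (at 0 within sector \<delta>'))))"


section \<open>Riesz-spectral operators\<close>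

definition schauder_basis :: "(nat \<Rightarrow> 'a::complex_normed_vector) \<Rightarrow> bool" where
  "schauder_basis \<phi> \<longleftrightarrow> (\<forall>x. \<exists>!a. (\<lambda>k. scaleC (a k) (\<phi> k)) sums x)"

definition riesz_basis2 :: "(nat \<Rightarrow> 'a::complex_normed_vector) \<Rightarrow> bool" where
  "riesz_basis2 \<phi> \<longleftrightarrow> schauder_basis \<phi> \<and>
     (\<exists>c1>0. \<exists>c2>0. \<forall>a. summable (\<lambda>k. (cmod (a k))\<^sup>2) \<longrightarrow>
        summable (\<lambda>k. scaleC (a k) (\<phi> k)) \<and>
        c1 * (\<Sum>k. (cmod (a k))\<^sup>2) \<le> (norm (\<Sum>k. scaleC (a k) (\<phi> k)))\<^sup>2 \<and>
        (norm (\<Sum>k. scaleC (a k) (\<phi> k)))\<^sup>2 \<le> c2 * (\<Sum>k. (cmod (a k))\<^sup>2))"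

definition segmentwise_disconnected :: "complex set \<Rightarrow> bool" where
  "segmentwise_disconnected S \<longleftrightarrow>
     (\<forall>p\<in>S. \<forall>q\<in>S. p \<noteq> q \<longrightarrow> \<not> closed_segment p q \<subseteq> S)"

definition riesz_spectral ::
  "'a::complex_normed_vector set \<Rightarrow> ('a \<Rightarrow> 'a) \<Rightarrow> bool" where
  "riesz_spectral D A \<longleftrightarrow> clinear_on D A \<and> closed_operator D A \<and>
     (\<exists>ev \<phi>. (\<forall>n. \<phi> n \<in> D \<and> \<phi> n \<noteq> 0 \<and> A (\<phi> n) = scaleC (ev n) (\<phi> n)) \<and>
        riesz_basis2 \<phi> \<and> segmentwise_disconnected (closure (range ev)))"


section \<open>Boundary control systems\<close>

definition bcs_domain :: "'x set \<Rightarrow> ('x \<Rightarrow> 'u::zero) \<Rightarrow> 'x set" where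
  "bcs_domain DA Gh = {x \<in> DA. Gh x = 0}"

definition lifting_operator ::
  "'x::cbanach set \<Rightarrow> ('x \<Rightarrow> 'x) \<Rightarrow> ('x \<Rightarrow> 'u::cbanach) \<Rightarrow> ('u \<Rightarrow> 'x) \<Rightarrow> bool" where
  "lifting_operator DA Ah Gh G \<longleftrightarrow> bounded_clinear G \<and>
     (\<forall>u. G u \<in> DA) \<and> bounded_clinear (\<lambda>u. Ah (G u)) \<and> (\<forall>u. Gh (G u) = u)"

text \<open>
  \<open>(DA, Ah)\<close> and \<open>(DG, Gh)\<close> are the operators \<open>\<hat>A\<close> and \<open>\<hat>G\<close> with their domains; \<open>T\<close> is the semigroup
  generated by the associated operator, and \<open>G\<close> the chosen lifting operator.
\<close>

definition boundary_control_system ::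
  "'x::cbanach set \<Rightarrow> ('x \<Rightarrow> 'x) \<Rightarrow> 'x set \<Rightarrow> ('x \<Rightarrow> 'u::cbanach) \<Rightarrow>
   (real \<Rightarrow> 'x \<Rightarrow> 'x) \<Rightarrow> ('u \<Rightarrow> 'x) \<Rightarrow> bool" where
  "boundary_control_system DA Ah DG Gh T G \<longleftrightarrow>
     clinear_on DA Ah \<and> clinear_on DG Gh \<and> DA \<subseteq> DG \<and>
     generates (bcs_domain DA Gh) Ah T \<and>
     lifting_operator DA Ah Gh G"


section \<open>Extrapolation space and extrapolated semigroup\<close>

text \<open>
  The completion of \<open>X\<close> with respect to \<open>\<parallel>(aI - A)\<^sup>-\<^sup>1 x\<parallel>\<close> is rendered as an arbitrary Banach space
  \<open>'y\<close> together with an embedding \<open>j\<close> of \<open>X\<close> onto a dense subspace that is isometric for this norm;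
  this determines \<open>('y, j)\<close> up to isometric isomorphism.  ``Being in \<open>X\<close>'' becomes membership in
  \<open>range j\<close>.
\<close>

definition extrapolation_space ::
  "complex \<Rightarrow> 'x::cbanach set \<Rightarrow> ('x \<Rightarrow> 'x) \<Rightarrow> ('x \<Rightarrow> 'y::cbanach) \<Rightarrow> bool" where
  "extrapolation_space a D A j \<longleftrightarrow> a \<in> resolvent_set D A \<and>
     Vector_Spaces.linear scaleC scaleC j \<and>
     (\<forall>x. norm (j x) = norm (resolvent D A a x)) \<and>
     closure (range j) = UNIV"

definition extrapolated_semigroup ::
  "('x::cbanach \<Rightarrow> 'y::cbanach) \<Rightarrow> (real \<Rightarrow> 'x \<Rightarrow> 'x) \<Rightarrow> (real \<Rightarrow> 'y \<Rightarrow> 'y) \<Rightarrow> bool" where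
  "extrapolated_semigroup j T Tm \<longleftrightarrow> C0_semigroup Tm \<and> (\<forall>t\<ge>0. \<forall>x. Tm t (j x) = j (T t x))"

text \<open>The operator \<open>\<hat>A G - A\<^sub>-\<^sub>1 G\<close>, where \<open>A\<^sub>-\<^sub>1\<close> is the generator of \<open>Tm\<close>.\<close>

definition bcs_input_operator ::
  "('x::cbanach \<Rightarrow> 'y::cbanach) \<Rightarrow> (real \<Rightarrow> 'y \<Rightarrow> 'y) \<Rightarrow> ('x \<Rightarrow> 'x) \<Rightarrow> ('u \<Rightarrow> 'x) \<Rightarrow> 'u \<Rightarrow> 'y" where
  "bcs_input_operator j Tm Ah G u = j (Ah (G u)) - gen Tm (j (G u))"


section \<open>Inputs\<close>

text \<open>
  Elements of \<open>L\<^sub>\<infinity>(\<real>\<^sub>+, U)\<close> are represented by functions on \<open>\<real>\<close> of which only the values on \<open>{0..}\<close>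
  are relevant, up to null sets.  Borel measurability is strong measurability when \<open>U\<close> is
  separable, in particular when it is finite-dimensional.
\<close>

definition Linf_norm :: "(real \<Rightarrow> 'u::real_normed_vector) \<Rightarrow> real" where
  "Linf_norm u = real_of_ereal (esssup (lebesgue_on {0..}) (\<lambda>s. ereal (norm (u s))))"

definition Linf :: "(real \<Rightarrow> 'u::real_normed_vector) set" where
  "Linf = {u \<in> borel_measurable (lebesgue_on {0..}).
             esssup (lebesgue_on {0..}) (\<lambda>s. ereal (norm (u s))) < \<infinity>}"


section \<open>Mild solutions and admissibility\<close>

text \<open>
  The completion of a separable space is separable, so the topological sort constraint on \<open>'y\<close>,
  which the Bochner integral needs, costs no generality for separable \<open>X\<close>.  Integrability is
  stated explicitly because the integral of a non-integrable function is \<open>0\<close>.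
\<close>

definition convolution_integrable ::
  "(real \<Rightarrow> 'y \<Rightarrow> 'y::{cbanach, second_countable_topology}) \<Rightarrow> ('u \<Rightarrow> 'y) \<Rightarrow> real \<Rightarrow>
   (real \<Rightarrow> 'u) \<Rightarrow> bool" where
  "convolution_integrable Tm B t u \<longleftrightarrow> set_integrable lebesgue {0..t} (\<lambda>s. Tm (t - s) (B (u s)))"

definition input_convolution ::
  "(real \<Rightarrow> 'y \<Rightarrow> 'y::{cbanach, second_countable_topology}) \<Rightarrow> ('u \<Rightarrow> 'y) \<Rightarrow> real \<Rightarrow>
   (real \<Rightarrow> 'u) \<Rightarrow> 'y" where
  "input_convolution Tm B t u = (LINT s:{0..t}|lebesgue. Tm (t - s) (B (u s)))"

definition infty_admissible ::
  "('x \<Rightarrow> 'y::{cbanach, second_countable_topology}) \<Rightarrow> (real \<Rightarrow> 'y \<Rightarrow> 'y) \<Rightarrow>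
   ('u::cbanach \<Rightarrow> 'y) \<Rightarrow> bool" where
  "infty_admissible j Tm B \<longleftrightarrow> bounded_clinear B \<and>
     (\<exists>t>0. \<forall>u\<in>Linf. convolution_integrable Tm B t u \<and> input_convolution Tm B t u \<in> range j)"

text \<open>
  \<open>\<phi>\<close> is the \<open>X\<close>-valued solution map of \<open>\<dot>x = A\<^sub>-\<^sub>1 x + B u\<close>.  Its existence expresses that all values
  of the variation-of-constants formula lie in \<open>X\<close>.
\<close>

definition mild_solution_map ::
  "('x::cbanach \<Rightarrow> 'y::{cbanach, second_countable_topology}) \<Rightarrow> (real \<Rightarrow> 'x \<Rightarrow> 'x) \<Rightarrow>
   (real \<Rightarrow> 'y \<Rightarrow> 'y) \<Rightarrow> ('u::cbanach \<Rightarrow> 'y) \<Rightarrow> (real \<Rightarrow> 'x \<Rightarrow> (real \<Rightarrow> 'u) \<Rightarrow> 'x) \<Rightarrow> bool" where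
  "mild_solution_map j T Tm B \<phi> \<longleftrightarrow>
     (\<forall>t\<ge>0. \<forall>x. \<forall>u\<in>Linf. convolution_integrable Tm B t u \<and>
        j (\<phi> t x u) = j (T t x) + input_convolution Tm B t u)"

text \<open>
  The mild solution of the boundary control system is by definition given by the
  variation-of-constants formula with \<open>B = \<hat>A G - A\<^sub>-\<^sub>1 G\<close>.
\<close>

definition bcs_mild_solution_map ::
  "('x::cbanach \<Rightarrow> 'y::{cbanach, second_countable_topology}) \<Rightarrow> (real \<Rightarrow> 'x \<Rightarrow> 'x) \<Rightarrow>
   (real \<Rightarrow> 'y \<Rightarrow> 'y) \<Rightarrow> ('x \<Rightarrow> 'x) \<Rightarrow> ('u::cbanach \<Rightarrow> 'x) \<Rightarrow>
   (real \<Rightarrow> 'x \<Rightarrow> (real \<Rightarrow> 'u) \<Rightarrow> 'x) \<Rightarrow> bool" where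
  "bcs_mild_solution_map j T Tm Ah G \<phi> \<longleftrightarrow>
     (\<forall>t\<ge>0. \<forall>x. \<forall>u\<in>Linf.
        set_integrable lebesgue {0..t} (\<lambda>r. Tm (t - r) (j (Ah (G (u r))) - gen Tm (j (G (u r))))) \<and>
        j (\<phi> t x u) = j (T t x) +
          (LINT r:{0..t}|lebesgue. Tm (t - r) (j (Ah (G (u r))) - gen Tm (j (G (u r))))))"


section \<open>Input-to-state stability\<close>

definition class_Kinf :: "(real \<Rightarrow> real) \<Rightarrow> bool" where
  "class_Kinf \<gamma> \<longleftrightarrow> continuous_on {0..} \<gamma> \<and> strict_mono_on {0..} \<gamma> \<and> \<gamma> 0 = 0 \<and>
     (\<forall>M. \<exists>r\<ge>0. M < \<gamma> r)"

definition class_KL :: "(real \<Rightarrow> real \<Rightarrow> real) \<Rightarrow> bool" where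
  "class_KL \<beta> \<longleftrightarrow> continuous_on ({0..} \<times> {0..}) (\<lambda>(r, t). \<beta> r t) \<and>
     (\<forall>t\<ge>0. strict_mono_on {0..} (\<lambda>r. \<beta> r t) \<and> \<beta> 0 t = 0) \<and>
     (\<forall>r>0. strict_antimono_on {0..} (\<beta> r) \<and> (\<beta> r \<longlongrightarrow> 0) at_top)"

text \<open>
  Inputs are compared almost everywhere in the causality axiom, so that \<open>\<phi> t x\<close> is in particular
  well defined on equivalence classes.
\<close>

definition forward_complete_control_system ::
  "(real \<Rightarrow> 'u) set \<Rightarrow> ((real \<Rightarrow> 'u) \<Rightarrow> real) \<Rightarrow>
   (real \<Rightarrow> 'x::real_normed_vector \<Rightarrow> (real \<Rightarrow> 'u) \<Rightarrow> 'x) \<Rightarrow> bool" where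
  "forward_complete_control_system \<U> normU \<phi> \<longleftrightarrow>
     \<comment> \<open>shift invariance and concatenation\<close>
     (\<forall>u\<in>\<U>. \<forall>t\<ge>0. (\<lambda>s. u (t + s)) \<in> \<U> \<and> normU (\<lambda>s. u (t + s)) \<le> normU u) \<and>
     (\<forall>u\<in>\<U>. \<forall>v\<in>\<U>. \<forall>t>0. (\<lambda>s. if s \<le> t then u s else v (s - t)) \<in> \<U>) \<and>
     \<comment> \<open>identity\<close>
     (\<forall>x. \<forall>u\<in>\<U>. \<phi> 0 x u = x) \<and>
     \<comment> \<open>causality\<close>
     (\<forall>t\<ge>0. \<forall>x. \<forall>u\<in>\<U>. \<forall>v\<in>\<U>. (AE s in lebesgue_on {0..t}. u s = v s) \<longrightarrow> \<phi> t x u = \<phi> t x v) \<and>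
     \<comment> \<open>continuity\<close>
     (\<forall>x. \<forall>u\<in>\<U>. continuous_on {0..} (\<lambda>t. \<phi> t x u)) \<and>
     \<comment> \<open>cocycle property\<close>
     (\<forall>t\<ge>0. \<forall>h\<ge>0. \<forall>x. \<forall>u\<in>\<U>. \<phi> h (\<phi> t x u) (\<lambda>s. u (t + s)) = \<phi> (t + h) x u)"

definition ISS ::
  "(real \<Rightarrow> 'u) set \<Rightarrow> ((real \<Rightarrow> 'u) \<Rightarrow> real) \<Rightarrow>
   (real \<Rightarrow> 'x::real_normed_vector \<Rightarrow> (real \<Rightarrow> 'u) \<Rightarrow> 'x) \<Rightarrow> bool" where
  "ISS \<U> normU \<phi> \<longleftrightarrow> forward_complete_control_system \<U> normU \<phi> \<and>
     (\<exists>\<beta> \<gamma>. class_KL \<beta> \<and> class_Kinf \<gamma> \<and>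
        (\<forall>x. \<forall>u\<in>\<U>. \<forall>t\<ge>0. norm (\<phi> t x u) \<le> \<beta> (norm x) t + \<gamma> (normU u)))"

end

(*
  A Riesz basis of eigenvectors \<phi>_n with eigenvalues \<lambda>_n identifies X with l_2, where T acts by
  multiplication with exp (\<lambda>_n t). Exponential stability gives Re \<lambda>_n \<le> -\<omega>, and analyticity
  puts the spectrum in a sector, so |a - \<lambda>_n| \<le> \<kappa> |Re \<lambda>_n|. The operator (a - A_-1)^-1 is an
  isometry J of X_-1 onto X, and C = J B is bounded from U to X. The n-th coordinate of the
  convolution with B u is (a - \<lambda>_n) times that of the convolution with C u, hence at most
  \<kappa> \<gamma>_n times the norm of u, where \<gamma>_n bounds the n-th coordinate of C. Since dim U is finite,
  (\<gamma>_n) is in l_2; this gives admissibility, continuity in time and the ISS estimate at once.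
*)
theory Submission
  imports Defs "HOL-Complex_Analysis.Conformal_Mappings"
begin

section \<open>Complex linear maps\<close>

text \<open>The obstacle is that the convolution integral lives in X_-1, where no coordinates are at
  hand. The state is therefore not extracted from the integral. It is built in X as a basis series
  with the coordinates it must have, and is identified with the integral afterwards, by applying the
  injective map J and then the coordinates of X, which separate points. Continuity, causality and
  the cocycle property thus become facts about scalar convolutions with exp (\<lambda> t). The
  unboundedness of B costs a factor a - \<lambda> per coordinate, but the kernel exp (\<lambda> t)
  has L_1 norm 1 / |Re \<lambda>|. The sector condition makes these two cancel up to \<kappa>. It
  comes from the identity theorem: the analytic extension acts on an eigenvector as exp (\<lambda>
  z), so its operator norms at two conjugate points 1 + is and 1 - is bound |Im \<lambda>| by an
  affine function of -Re \<lambda>; stability absorbs the additive constant. Since u(s) varies with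
  s, square summability of the coordinates of each single C u is not enough: their suprema over the
  unit ball of U must be square summable, and this is what dim U < infinity provides.\<close>

lemma scaleC_scaleR_commute:
  "scaleC c (scaleR r x) = scaleR r (scaleC c (x::'a::complex_vector))"
  by (simp add: scaleR_scaleC scaleC_scaleC mult.commute)

lemma scaleC_zero_left [simp]: "scaleC 0 (x::'a::complex_vector) = 0"
  by (metis add_cancel_right_right add_0 scaleC_add_left)

lemma scaleC_zero_right [simp]: "scaleC c (0::'a::complex_vector) = 0"
  by (metis add_cancel_right_right add_0 scaleC_add_right)

lemma scaleC_minus_right: "scaleC c (- (x::'a::complex_vector)) = - scaleC c x"
  by (metis add_eq_0_iff scaleC_add_right scaleC_zero_right)

lemma scaleC_diff_right: "scaleC c (x - (y::'a::complex_vector)) = scaleC c x - scaleC c y"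
  by (metis diff_conv_add_uminus scaleC_add_right scaleC_minus_right)

lemma scaleC_minus_left: "scaleC (- c) (x::'a::complex_vector) = - scaleC c x"
  by (metis add.right_inverse neg_eq_iff_add_eq_0 scaleC_add_left scaleC_zero_left)

lemma scaleC_diff_left: "scaleC (b - c) (x::'a::complex_vector) = scaleC b x - scaleC c x"
  by (metis diff_conv_add_uminus scaleC_add_left scaleC_minus_left)

lemma bounded_linear_scaleC_right: "bounded_linear (\<lambda>x::'a::complex_normed_vector. scaleC c x)"
  by (rule bounded_linear_intro[where K="cmod c"])
     (simp_all add: scaleC_add_right scaleC_scaleR_commute norm_scaleC mult.commute)

lemma bounded_linear_scaleC_left: "bounded_linear (\<lambda>c. scaleC c (x::'a::complex_normed_vector))"
  by (rule bounded_linear_intro[where K="norm x"])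
     (simp_all add: scaleC_add_left scaleR_scaleC scaleC_scaleC norm_scaleC scaleR_conv_of_real)

lemma linear_scaleC_iff:
  "Vector_Spaces.linear scaleC scaleC (f :: 'a::complex_vector \<Rightarrow> 'b::complex_vector) \<longleftrightarrow>
     (\<forall>x y. f (x + y) = f x + f y) \<and> (\<forall>c x. f (scaleC c x) = scaleC c (f x))"
  by (simp add: Vector_Spaces.linear_iff vector_space_scaleC)

text \<open>Separates the real structure from complex homogeneity, so that the library for
  \<open>bounded_linear\<close> (limits, sums, \<open>onorm\<close>, integrals) becomes
  available.\<close>

lemma bounded_clinear_iff:
  "bounded_clinear f \<longleftrightarrow> bounded_linear f \<and> (\<forall>c x. f (scaleC c x) = scaleC c (f x))"
proof
  assume f: "bounded_clinear f"
  then obtain K where K: "\<And>x. norm (f x) \<le> K * norm x" unfolding bounded_clinear_def by blast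
  from f show "bounded_linear f \<and> (\<forall>c x. f (scaleC c x) = scaleC c (f x))"
    unfolding bounded_clinear_def linear_scaleC_iff
    by (auto intro!: bounded_linear_intro[where K=K] simp: scaleR_scaleC K mult.commute[of _ K])
next
  assume f: "bounded_linear f \<and> (\<forall>c x. f (scaleC c x) = scaleC c (f x))"
  then obtain K where "\<forall>x. norm (f x) \<le> norm x * K" using bounded_linear.bounded by blast
  then have "\<exists>K. \<forall>x. norm (f x) \<le> K * norm x" by (auto simp: mult.commute)
  with f show "bounded_clinear f"
    unfolding bounded_clinear_def linear_scaleC_iff by (simp add: linear_simps)
qed

lemmas bounded_clinearD = bounded_clinear_iff[THEN iffD1, THEN conjunct1]
lemmas bounded_clinear_scaleC = bounded_clinear_iff[THEN iffD1, THEN conjunct2, rule_format]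

section \<open>Coordinates in finite-dimensional spaces\<close>

text \<open>The norm is arbitrary, so continuity of the coordinates has to be proved. In the
  induction step the span of \<open>S\<close> is complete by the induction hypothesis, hence the new
  vector \<open>e\<close> keeps a positive distance from it, and that distance controls its
  coefficient.\<close>

lemma finite_independent_bounded_coordinates:
  fixes S :: "'a::complex_normed_vector set"
  assumes "finite S" and "\<not> module.dependent scaleC S"
  shows "\<exists>K\<ge>0. \<forall>c. (\<Sum>e\<in>S. cmod (c e)) \<le> K * norm (\<Sum>e\<in>S. scaleC (c e) e)"
  using assms
proof (induction S rule: finite_induct)
  case empty
  then show ?case by auto
next
  case (insert e S)
  interpret vector_space "scaleC :: complex \<Rightarrow> 'a \<Rightarrow> 'a"
    by (rule vector_space_scaleC)
  let ?L = "\<lambda>c. \<Sum>f\<in>S. scaleC (c f) f"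
  have notin: "e \<notin> span S" and "independent S"
    using insert.prems insert.hyps by (auto simp: independent_insert)
  with insert.IH obtain K where "K \<ge> 0"
    and K: "\<And>c. (\<Sum>f\<in>S. cmod (c f)) \<le> K * norm (?L c)" by blast
  \<comment> \<open>If combinations of \<open>S\<close> came arbitrarily close to \<open>e\<close>,
    their coefficients would be Cauchy by the induction hypothesis, and the limits would put
    \<open>e\<close> into the span.\<close>
  have "\<exists>d>0. \<forall>c. d \<le> norm (e - ?L c)"
  proof (rule ccontr)
    assume "\<not> ?thesis"
    then have "\<forall>n::nat. \<exists>c. norm (e - ?L c) < inverse (real (Suc n))"
      by (metis inverse_positive_iff_positive not_le of_nat_0_less_iff zero_less_Suc)
    then obtain c where c: "\<And>n. norm (e - ?L (c n)) < inverse (real (Suc n))" by metis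
    have lim: "(\<lambda>n. ?L (c n)) \<longlonglongrightarrow> e"
    proof (rule LIM_zero_cancel, rule tendsto_norm_zero_cancel, rule tendsto_sandwich[where f="\<lambda>_. 0" and h="\<lambda>n. inverse (real (Suc n))"])
      show "\<forall>\<^sub>F n in sequentially. norm (?L (c n) - e) \<le> inverse (real (Suc n))"
        using c by (intro always_eventually allI) (metis norm_minus_commute less_imp_le)
    qed (use LIMSEQ_inverse_real_of_nat in auto)
    have Cauchy_coeff: "Cauchy (\<lambda>n. c n f)" if "f \<in> S" for f
    proof (rule metric_CauchyI)
      fix r :: real assume "r > 0"
      have "Cauchy (\<lambda>n. ?L (c n))" using lim LIMSEQ_imp_Cauchy by blast
      then obtain N where N: "\<And>m n. m \<ge> N \<Longrightarrow> n \<ge> N \<Longrightarrow> dist (?L (c m)) (?L (c n)) < r / (K + 1)"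
        using \<open>r > 0\<close> \<open>K \<ge> 0\<close> metric_CauchyD[of "\<lambda>n. ?L (c n)" "r / (K + 1)"] by auto
      have "dist (c m f) (c n f) < r" if "m \<ge> N" "n \<ge> N" for m n
      proof -
        have "dist (c m f) (c n f) \<le> (\<Sum>f\<in>S. cmod (c m f - c n f))"
          unfolding dist_norm using insert.hyps \<open>f \<in> S\<close> by (intro member_le_sum) auto
        also have "\<dots> \<le> K * norm (?L (\<lambda>f. c m f - c n f))" by (rule K)
        also have "?L (\<lambda>f. c m f - c n f) = ?L (c m) - ?L (c n)"
          by (simp add: scaleC_diff_left sum_subtractf)
        also have "K * norm \<dots> \<le> K * (r / (K + 1))"
          using N[OF that] \<open>K \<ge> 0\<close> by (intro mult_left_mono) (auto simp: dist_norm)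
        also have "\<dots> < r" using \<open>r > 0\<close> \<open>K \<ge> 0\<close> by (simp add: field_simps)
        finally show ?thesis .
      qed
      then show "\<exists>M. \<forall>m\<ge>M. \<forall>n\<ge>M. dist (c m f) (c n f) < r" by blast
    qed
    define c' where "c' f = lim (\<lambda>n. c n f)" for f
    have "(\<lambda>n. c n f) \<longlonglongrightarrow> c' f" if "f \<in> S" for f
      using Cauchy_coeff[OF that] unfolding c'_def by (simp add: Cauchy_convergent_iff convergent_LIMSEQ_iff)
    then have "(\<lambda>n. ?L (c n)) \<longlonglongrightarrow> ?L c'"
      by (intro tendsto_sum bounded_linear.tendsto[OF bounded_linear_scaleC_left]) auto
    with lim have "e = ?L c'" by (rule LIMSEQ_unique)
    also have "\<dots> \<in> span S" by (intro span_sum span_scale span_base)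
    finally show False using notin by simp
  qed
  then obtain d where "d > 0" and d: "\<And>c. d \<le> norm (e - ?L c)" by blast
  have low: "d * cmod b \<le> norm (scaleC b e + ?L c)" for b c
  proof (cases "b = 0")
    case False
    have "scaleC b (?L (\<lambda>f. - c f / b)) = ?L (\<lambda>f. - c f)"
      using False by (simp add: scale_sum_right scaleC_scaleC)
    then have "scaleC b e + ?L c = scaleC b (e - ?L (\<lambda>f. - c f / b))"
      by (simp add: scaleC_diff_right scaleC_add_right scaleC_minus_left sum_negf)
    then show ?thesis
      using mult_left_mono[OF d[of "\<lambda>f. - c f / b"], of "cmod b"]
      by (simp add: norm_scaleC mult.commute)
  qed simp
  \<comment> \<open>With v the full combination, the coefficient of \<open>e\<close> is at most |v|
    / d. Removing its term leaves a vector of norm at most |v| (1 + |e| / d), to which the old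
    constant \<open>K\<close> applies.\<close>
  have "(\<Sum>f\<in>insert e S. cmod (c f)) \<le> (1 / d + K * (1 + norm e / d)) *
      norm (\<Sum>f\<in>insert e S. scaleC (c f) f)" for c
  proof -
    let ?v = "scaleC (c e) e + ?L c"
    have b: "cmod (c e) \<le> norm ?v / d"
      using low[of "c e" c] \<open>d > 0\<close> by (simp add: field_simps)
    have "norm (?L c) \<le> norm ?v + cmod (c e) * norm e"
      using norm_triangle_ineq4[of ?v "scaleC (c e) e"] by (simp add: norm_scaleC)
    also have "\<dots> \<le> norm ?v + norm ?v / d * norm e"
      using b by (intro add_left_mono mult_right_mono) auto
    finally have "K * norm (?L c) \<le> K * (norm ?v + norm ?v / d * norm e)"
      using \<open>K \<ge> 0\<close> by (rule mult_left_mono)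
    with K[of c] b insert.hyps show ?thesis by (simp add: algebra_simps)
  qed
  moreover have "1 / d + K * (1 + norm e / d) \<ge> 0" using \<open>d > 0\<close> \<open>K \<ge> 0\<close> by simp
  ultimately show ?case by blast
qed

lemma finite_dim_coordinates:
  assumes "finite_dim_space TYPE('u::complex_normed_vector)"
  obtains E :: "'u::complex_normed_vector set" and p :: "'u \<Rightarrow> 'u \<Rightarrow> complex"
  where "finite E" "\<And>e. e \<in> E \<Longrightarrow> bounded_linear (p e)" "\<And>u. u = (\<Sum>e\<in>E. scaleC (p e u) e)"
proof -
  from assms obtain E :: "'u set" where "finite_dimensional_vector_space scaleC E"
    unfolding finite_dim_space_def by blast
  then interpret finite_dimensional_vector_space "scaleC :: complex \<Rightarrow> 'u \<Rightarrow> 'u" E .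
  let ?p = "\<lambda>e u. representation E u e"
  have sum: "(\<Sum>e\<in>E. scaleC (?p e u) e) = u" for u
    using sum_representation_eq[of E u E] independent_Basis finite_Basis span_Basis by auto
  obtain K where "K \<ge> 0" and K: "\<And>c. (\<Sum>e\<in>E. cmod (c e)) \<le> K * norm (\<Sum>e\<in>E. scaleC (c e) e)"
    using finite_independent_bounded_coordinates[OF finite_Basis independent_Basis] by blast
  have "bounded_linear (?p e)" if "e \<in> E" for e
  proof (rule bounded_linear_intro[where K=K])
    show "?p e (x + y) = ?p e x + ?p e y" for x y
      using representation_add[OF independent_Basis] span_Basis by auto
    show "?p e (scaleR r x) = scaleR r (?p e x)" for r x
      using representation_scale[OF independent_Basis] span_Basis
      by (simp add: scaleR_scaleC scaleR_conv_of_real)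
    show "norm (?p e x) \<le> norm x * K" for x
    proof -
      have "norm (?p e x) \<le> (\<Sum>e\<in>E. cmod (?p e x))"
        using that finite_Basis by (intro member_le_sum) auto
      also have "\<dots> \<le> K * norm x" using K[of "\<lambda>e. ?p e x"] by (simp add: sum)
      finally show ?thesis by (simp add: mult.commute)
    qed
  qed
  with finite_Basis sum show ?thesis by (intro that[of E ?p]) auto
qed

section \<open>Riesz bases\<close>

locale riesz_basis =
  fixes \<phi> :: "nat \<Rightarrow> 'a::cbanach"
  assumes riesz: "riesz_basis2 \<phi>"
begin

text \<open>These are the biorthogonal functionals of the basis; uniqueness of Schauder expansions
  makes the description proper.\<close>

definition coord :: "'a \<Rightarrow> nat \<Rightarrow> complex" where
  "coord x = (THE a. (\<lambda>k. scaleC (a k) (\<phi> k)) sums x)"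

lemma ex1_coord: "\<exists>!a. (\<lambda>k. scaleC (a k) (\<phi> k)) sums x"
  using riesz by (simp add: riesz_basis2_def schauder_basis_def)

lemma coord_sums: "(\<lambda>k. scaleC (coord x k) (\<phi> k)) sums x"
  unfolding coord_def by (rule theI'[OF ex1_coord])

lemma coord_eqI: "(\<lambda>k. scaleC (a k) (\<phi> k)) sums x \<Longrightarrow> coord x = a"
  using ex1_coord coord_sums by blast

lemma eq_if_coord_eq: "(\<And>k. coord x k = coord y k) \<Longrightarrow> x = y"
  using coord_sums[of x] coord_sums[of y] by (auto simp: sums_unique2)

lemma coord_add: "coord (x + y) k = coord x k + coord y k"
proof -
  have "coord (x + y) = (\<lambda>k. coord x k + coord y k)"
    using sums_add[OF coord_sums[of x] coord_sums[of y]]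
    by (intro coord_eqI) (simp add: scaleC_add_left)
  then show ?thesis by simp
qed

lemma coord_scaleC: "coord (scaleC c x) k = c * coord x k"
proof -
  have "coord (scaleC c x) = (\<lambda>k. c * coord x k)"
    using bounded_linear.sums[OF bounded_linear_scaleC_right coord_sums, of c x]
    by (intro coord_eqI) (simp add: scaleC_scaleC)
  then show ?thesis by simp
qed

lemma riesz_bounds:
  obtains c1 c2 where "c1 > 0" and "c2 > 0"
    and "\<And>a. summable (\<lambda>k. (cmod (a k))\<^sup>2) \<Longrightarrow> summable (\<lambda>k. scaleC (a k) (\<phi> k))"
    and "\<And>a. summable (\<lambda>k. (cmod (a k))\<^sup>2) \<Longrightarrow>
           c1 * (\<Sum>k. (cmod (a k))\<^sup>2) \<le> (norm (\<Sum>k. scaleC (a k) (\<phi> k)))\<^sup>2"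
    and "\<And>a. summable (\<lambda>k. (cmod (a k))\<^sup>2) \<Longrightarrow>
           (norm (\<Sum>k. scaleC (a k) (\<phi> k)))\<^sup>2 \<le> c2 * (\<Sum>k. (cmod (a k))\<^sup>2)"
proof -
  from riesz obtain c1 c2 where "c1 > 0" "c2 > 0"
    and bnd: "\<forall>a. summable (\<lambda>k. (cmod (a k))\<^sup>2) \<longrightarrow>
        summable (\<lambda>k. scaleC (a k) (\<phi> k)) \<and>
        c1 * (\<Sum>k. (cmod (a k))\<^sup>2) \<le> (norm (\<Sum>k. scaleC (a k) (\<phi> k)))\<^sup>2 \<and>
        (norm (\<Sum>k. scaleC (a k) (\<phi> k)))\<^sup>2 \<le> c2 * (\<Sum>k. (cmod (a k))\<^sup>2)"
    unfolding riesz_basis2_def by (elim conjE exE) (rule that)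
  show ?thesis
    by (rule that[OF \<open>c1 > 0\<close> \<open>c2 > 0\<close>]) (simp_all add: bnd[rule_format])
qed

lemma coord_suminf:
  assumes "summable (\<lambda>k. (cmod (a k))\<^sup>2)"
  shows "coord (\<Sum>k. scaleC (a k) (\<phi> k)) = a"
proof (rule riesz_bounds)
  assume "\<And>a. summable (\<lambda>k. (cmod (a k))\<^sup>2) \<Longrightarrow> summable (\<lambda>k. scaleC (a k) (\<phi> k))"
  from summable_sums[OF this[OF assms]] show ?thesis by (rule coord_eqI)
qed

text \<open>The Riesz inequalities speak only of sequences already known to be square summable. They
  are applied to truncated expansions, extended by 0; the partial sums of \<open>x\<close> converge
  and are therefore bounded, which yields square summability, and then the estimate in the
  limit.\<close>

lemma coord_bound:
  obtains c where "c > 0" and "\<And>x. summable (\<lambda>k. (cmod (coord x k))\<^sup>2)"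
    and "\<And>x. (\<Sum>k. (cmod (coord x k))\<^sup>2) \<le> c * (norm x)\<^sup>2"
proof -
  obtain c1 where "c1 > 0" and c1: "\<And>a. summable (\<lambda>k. (cmod (a k))\<^sup>2) \<Longrightarrow>
      c1 * (\<Sum>k. (cmod (a k))\<^sup>2) \<le> (norm (\<Sum>k. scaleC (a k) (\<phi> k)))\<^sup>2"
    by (rule riesz_bounds) blast
  have partial: "c1 * (\<Sum>k<n. (cmod (coord x k))\<^sup>2) \<le> (norm (\<Sum>k<n. scaleC (coord x k) (\<phi> k)))\<^sup>2" for n x
  proof -
    let ?a = "\<lambda>k. if k < n then coord x k else 0"
    have sq: "(\<lambda>k. (cmod (?a k))\<^sup>2) sums (\<Sum>k<n. (cmod (coord x k))\<^sup>2)"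
      using sums_If_finite[of "\<lambda>k. k < n" "\<lambda>k. (cmod (coord x k))\<^sup>2"]
      by (simp add: if_distrib[of "\<lambda>c. (cmod c)\<^sup>2"] lessThan_def cong: if_cong)
    have "(\<lambda>k. scaleC (?a k) (\<phi> k)) sums (\<Sum>k<n. scaleC (coord x k) (\<phi> k))"
      using sums_If_finite[of "\<lambda>k. k < n" "\<lambda>k. scaleC (coord x k) (\<phi> k)"]
      by (simp add: if_distrib[of "\<lambda>c. scaleC c _"] lessThan_def cong: if_cong)
    then show ?thesis
      using c1[of ?a] sq by (simp add: sums_iff)
  qed
  have lim: "(\<lambda>n. (norm (\<Sum>k<n. scaleC (coord x k) (\<phi> k)))\<^sup>2) \<longlonglongrightarrow> (norm x)\<^sup>2" for x
    using coord_sums[of x] unfolding sums_def by (intro tendsto_power tendsto_norm)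
  have summable: "summable (\<lambda>k. (cmod (coord x k))\<^sup>2)" for x
  proof -
    from lim[of x] have "Bseq (\<lambda>n. (norm (\<Sum>k<n. scaleC (coord x k) (\<phi> k)))\<^sup>2)"
      by (intro convergent_imp_Bseq convergentI)
    then obtain b where b: "\<And>n. (norm (\<Sum>k<n. scaleC (coord x k) (\<phi> k)))\<^sup>2 \<le> b"
      unfolding Bseq_def by (auto simp: abs_if split: if_splits)
    have "(\<Sum>k<n. (cmod (coord x k))\<^sup>2) \<le> b / c1" for n
      using order_trans[OF partial b] \<open>c1 > 0\<close> by (simp add: field_simps)
    then show ?thesis
      by (intro summableI_nonneg_bounded[where x="b / c1"]) auto
  qed
  have "c1 * (\<Sum>k. (cmod (coord x k))\<^sup>2) \<le> (norm x)\<^sup>2" for x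
    by (rule LIMSEQ_le[OF tendsto_mult[OF tendsto_const summable_LIMSEQ[OF summable]] lim])
       (use partial in blast)
  then have "(\<Sum>k. (cmod (coord x k))\<^sup>2) \<le> inverse c1 * (norm x)\<^sup>2" for x
    using \<open>c1 > 0\<close> by (simp add: field_simps)
  with summable \<open>c1 > 0\<close> show ?thesis by (intro that[of "inverse c1"]) auto
qed

lemma coord_square_summable: "summable (\<lambda>k. (cmod (coord x k))\<^sup>2)"
  by (rule coord_bound)

lemma bounded_linear_coord: "bounded_linear (\<lambda>x. coord x k)"
proof (rule coord_bound)
  fix c :: real assume "c > 0" and c: "\<And>x. summable (\<lambda>k. (cmod (coord x k))\<^sup>2)"
    "\<And>x. (\<Sum>k. (cmod (coord x k))\<^sup>2) \<le> c * (norm x)\<^sup>2"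
  show ?thesis
  proof (rule bounded_linear_intro[where K="sqrt c"])
    show "coord (scaleR r x) k = scaleR r (coord x k)" for r x
      by (simp add: scaleR_scaleC coord_scaleC scaleR_conv_of_real)
    show "norm (coord x k) \<le> norm x * sqrt c" for x
    proof (rule power2_le_imp_le)
      have "(cmod (coord x k))\<^sup>2 \<le> (\<Sum>k. (cmod (coord x k))\<^sup>2)"
        using sum_le_suminf[OF c(1), of "{k}"] by simp
      with c(2)[of x] show "(norm (coord x k))\<^sup>2 \<le> (norm x * sqrt c)\<^sup>2"
        using \<open>c > 0\<close> by (simp add: power_mult_distrib mult.commute)
    qed (use \<open>c > 0\<close> in auto)
  qed (rule coord_add)
qed

text \<open>A bounded operator passes through the expansion, so its values on the basis determine
  it. Used both for \<open>T t\<close> and for the resolvent.\<close>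

lemma coord_diagonal:
  assumes F: "bounded_clinear F" and eig: "\<And>k. F (\<phi> k) = scaleC (m k) (\<phi> k)"
  shows "coord (F x) k = m k * coord x k"
proof -
  have "(\<lambda>k. scaleC (m k * coord x k) (\<phi> k)) sums F x"
    using bounded_linear.sums[OF bounded_clinearD[OF F] coord_sums[of x]]
    by (simp add: bounded_clinear_scaleC[OF F] eig scaleC_scaleC mult.commute)
  then show ?thesis by (simp add: coord_eqI)
qed

lemma closed_subspace_eq_UNIV:
  assumes "closed S" and "module.subspace scaleC S" and "\<And>k. \<phi> k \<in> S"
  shows "S = UNIV"
proof -
  interpret vector_space "scaleC :: complex \<Rightarrow> 'a \<Rightarrow> 'a" by (rule vector_space_scaleC)
  have "(\<Sum>k<n. scaleC (coord x k) (\<phi> k)) \<in> S" for x n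
    using assms by (intro subspace_sum subspace_scale)
  with coord_sums show ?thesis
    unfolding sums_def by (metis UNIV_eq_I assms(1) closed_sequentially)
qed

text \<open>By the upper Riesz bound the tails of the expansion are dominated by the tails of the
  sum of \<open>(\<eta> k)\<^sup>2\<close>, uniformly in \<open>t\<close>. So \<open>f\<close> is a
  uniform limit of continuous partial sums.\<close>

lemma continuous_on_coord:
  assumes cont: "\<And>k. continuous_on S (\<lambda>t. coord (f t) k)"
    and bound: "\<And>t k. t \<in> S \<Longrightarrow> cmod (coord (f t) k) \<le> \<eta> k"
    and \<eta>: "summable (\<lambda>k. (\<eta> k)\<^sup>2)"
  shows "continuous_on S f"
proof (rule riesz_bounds)
  fix c :: real assume "c > 0"
    and c: "\<And>a. summable (\<lambda>k. (cmod (a k))\<^sup>2) \<Longrightarrow>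
           (norm (\<Sum>k. scaleC (a k) (\<phi> k)))\<^sup>2 \<le> c * (\<Sum>k. (cmod (a k))\<^sup>2)"
  let ?p = "\<lambda>n t. \<Sum>k<n. scaleC (coord (f t) k) (\<phi> k)"
  have tail: "(norm (f t - ?p n t))\<^sup>2 \<le> c * (\<Sum>k. (\<eta> (k + n))\<^sup>2)" if "t \<in> S" for t n
  proof -
    let ?a = "\<lambda>k. if k < n then 0 else coord (f t) k"
    have le: "(cmod (?a k))\<^sup>2 \<le> (if k < n then 0 else (\<eta> k)\<^sup>2)" for k
      using bound[OF that, of k] by (auto intro: power_mono)
    have \<eta>s: "(\<lambda>k. if k < n then 0 else (\<eta> k)\<^sup>2) sums (\<Sum>k. (\<eta> (k + n))\<^sup>2)"
      using sums_iff_shift[of "\<lambda>k. if k < n then 0 else (\<eta> k)\<^sup>2" n]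
        summable_sums[OF summable_ignore_initial_segment[OF \<eta>, of n]] by simp
    have sq: "summable (\<lambda>k. (cmod (?a k))\<^sup>2)"
      using le by (intro summable_comparison_test'[OF sums_summable[OF \<eta>s], of 0]) simp
    have "(\<lambda>k. scaleC (?a k) (\<phi> k)) sums (f t - ?p n t)"
    proof -
      have "(\<lambda>k. if k < n then scaleC (coord (f t) k) (\<phi> k) else 0) sums ?p n t"
        using sums_If_finite[of "\<lambda>k. k < n" "\<lambda>k. scaleC (coord (f t) k) (\<phi> k)"]
        by (simp add: lessThan_def)
      from sums_diff[OF coord_sums[of "f t"] this] show ?thesis
        by (rule back_subst[where P="\<lambda>g. g sums _"]) auto
    qed
    then have "(norm (f t - ?p n t))\<^sup>2 \<le> c * (\<Sum>k. (cmod (?a k))\<^sup>2)"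
      using c[OF sq] by (simp add: sums_iff)
    also have "\<dots> \<le> c * (\<Sum>k. (\<eta> (k + n))\<^sup>2)"
      using suminf_le[OF le sq sums_summable[OF \<eta>s]] \<eta>s \<open>c > 0\<close> by (simp add: sums_iff)
    finally show ?thesis .
  qed
  have "uniform_limit S ?p f sequentially"
  proof (rule uniform_limitI)
    fix e :: real assume "e > 0"
    have "(\<lambda>n. c * (\<Sum>k. (\<eta> (k + n))\<^sup>2)) \<longlonglongrightarrow> c * 0"
      using suminf_exist_split2[OF \<eta>] by (intro tendsto_intros)
    then have "\<forall>\<^sub>F n in sequentially. c * (\<Sum>k. (\<eta> (k + n))\<^sup>2) < e\<^sup>2"
      using \<open>e > 0\<close> by (intro order_tendstoD) auto
    then show "\<forall>\<^sub>F n in sequentially. \<forall>t\<in>S. dist (?p n t) (f t) < e"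
    proof eventually_elim
      case (elim n)
      have "dist (?p n t) (f t) < e" if "t \<in> S" for t
      proof -
        have "(norm (f t - ?p n t))\<^sup>2 < e\<^sup>2" using tail[OF that, of n] elim by linarith
        then have "norm (f t - ?p n t) < e" by (rule power2_less_imp_less) (use \<open>e > 0\<close> in simp)
        then show ?thesis by (simp add: dist_norm norm_minus_commute)
      qed
      then show ?case by blast
    qed
  qed
  then show ?thesis
    by (rule uniform_limit_theorem[rotated])
       (simp_all add: continuous_on_sum bounded_linear.continuous_on[OF bounded_linear_scaleC_left] cont)
qed

end

section \<open>Eigenvectors of semigroups\<close>

lemma exp_difference_quotient:
  "((\<lambda>h. (exp (\<mu> * complex_of_real h) - 1) / complex_of_real h) \<longlongrightarrow> \<mu>) (at_right 0)"
proof -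
  have "((\<lambda>z. exp (\<mu> * z)) has_field_derivative \<mu>) (at 0)"
    by (auto intro!: derivative_eq_intros)
  then have "((\<lambda>h. (exp (\<mu> * h) - 1) / h) \<longlongrightarrow> \<mu>) (at 0)"
    by (auto dest!: DERIV_D)
  moreover have "filterlim complex_of_real (at 0) (at_right 0)"
    by (rule filterlim_atI)
       (auto intro!: tendsto_eq_intros simp: eventually_at_filter)
  ultimately show ?thesis by (rule filterlim_compose)
qed

lemma C0_semigroupD:
  assumes "C0_semigroup T"
  shows "t \<ge> 0 \<Longrightarrow> bounded_clinear (T t)" and "T 0 x = x"
    and "s \<ge> 0 \<Longrightarrow> t \<ge> 0 \<Longrightarrow> T (s + t) x = T s (T t x)"
    and "((\<lambda>t. T t x) \<longlongrightarrow> x) (at_right 0)"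
  using assms unfolding C0_semigroup_def by (auto simp: fun_eq_iff)

text \<open>
  For \<open>h = t / n\<close>, the differences \<open>T (m h) x - e\<^sup>\<mu>\<^sup>m\<^sup>h x\<close> telescope into \<open>m\<close> terms of size \<open>o(h)\<close>;
  this needs neither strong continuity nor an integral.
\<close>

lemma semigroup_eigenvector:
  assumes T: "C0_semigroup T"
    and bound: "\<And>t y. t \<ge> 0 \<Longrightarrow> norm (T t y) \<le> M * norm y"
    and eig: "((\<lambda>h. (T h x - x) /\<^sub>R h) \<longlongrightarrow> scaleC \<mu> x) (at_right 0)"
    and "t \<ge> 0"
  shows "T t x = scaleC (exp (\<mu> * t)) x"
proof (cases "t = 0")
  case True
  then show ?thesis using C0_semigroupD(2)[OF T] by (simp add: scaleC_one)
next
  case False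
  with \<open>t \<ge> 0\<close> have "t > 0" by simp
  define e where "e h = T h x - scaleC (exp (\<mu> * complex_of_real h)) x" for h
  \<comment> \<open>The orbit and the exponential have the same derivative
    \<open>scaleC \<mu> x\<close> at 0, so their difference is o(h).\<close>
  have lim: "((\<lambda>h. e h /\<^sub>R h) \<longlongrightarrow> 0) (at_right 0)"
  proof -
    have "((\<lambda>h. (T h x - x) /\<^sub>R h - scaleC ((exp (\<mu> * complex_of_real h) - 1) / complex_of_real h) x)
        \<longlongrightarrow> scaleC \<mu> x - scaleC \<mu> x) (at_right 0)"
      by (intro tendsto_diff eig exp_difference_quotient
          bounded_linear.tendsto[OF bounded_linear_scaleC_left])
    moreover have "\<forall>\<^sub>F h in at_right 0. (T h x - x) /\<^sub>R h -
        scaleC ((exp (\<mu> * complex_of_real h) - 1) / complex_of_real h) x = e h /\<^sub>R h"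
      unfolding eventually_at_filter
      by (auto intro!: always_eventually simp: e_def scaleR_scaleC divide_inverse scaleC_scaleC[symmetric]
          scaleC_diff_left scaleC_diff_right scaleC_one mult.commute[of _ "inverse _"])
    ultimately show ?thesis by (simp add: tendsto_cong)
  qed
  have step: "norm (T (real n * h) x - scaleC (exp (\<mu> * complex_of_real h) ^ n) x)
      \<le> real n * M * norm (e h) * exp (cmod \<mu> * h) ^ n" if "h > 0" for n h
  proof (induction n)
    case 0
    then show ?case by (simp add: C0_semigroupD(2)[OF T] scaleC_one)
  next
    case (Suc n)
    let ?E = "exp (\<mu> * complex_of_real h)" and ?F = "exp (cmod \<mu> * h)"
    have lin: "bounded_clinear (T (real n * h))"
      using that by (intro C0_semigroupD(1)[OF T]) simp
    \<comment> \<open>The sign of \<open>M\<close> is not given; the bound at time 0 supplies what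
      is needed.\<close>
    have M: "0 \<le> M * norm (e h)"
      using order_trans[OF norm_ge_zero bound[of 0 "e h"]] by simp
    have F: "1 \<le> ?F" "1 \<le> ?F ^ Suc n" using that by (auto intro!: one_le_power simp del: power_Suc)
    have E: "cmod ?E \<le> ?F"
      using that by (auto simp: norm_exp_eq_Re intro!: order_trans[OF norm_exp])
         (metis complex_Re_le_cmod mult_right_mono less_imp_le)
    have "T (real (Suc n) * h) x = T (real n * h) (T h x)"
      using C0_semigroupD(3)[OF T, of "real n * h" h x] that by (simp add: algebra_simps)
    also have "\<dots> = T (real n * h) (e h) + scaleC ?E (T (real n * h) x)"
      by (simp add: e_def linear_diff[OF bounded_linear.linear[OF bounded_clinearD[OF lin]]] bounded_clinear_scaleC[OF lin])
    finally have "T (real (Suc n) * h) x - scaleC (?E ^ Suc n) x =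
        T (real n * h) (e h) + scaleC ?E (T (real n * h) x - scaleC (?E ^ n) x)"
      by (simp add: scaleC_diff_right scaleC_scaleC)
    then have "norm (T (real (Suc n) * h) x - scaleC (?E ^ Suc n) x) \<le>
        norm (T (real n * h) (e h)) + cmod ?E * norm (T (real n * h) x - scaleC (?E ^ n) x)"
      by (metis norm_triangle_ineq norm_scaleC)
    also have "\<dots> \<le> M * norm (e h) + ?F * (real n * M * norm (e h) * ?F ^ n)"
      using that by (intro add_mono bound mult_mono E Suc.IH) auto
    also have "\<dots> \<le> M * norm (e h) * ?F ^ Suc n + ?F * (real n * M * norm (e h) * ?F ^ n)"
      using mult_left_mono[OF F(2) M] by simp
    also have "\<dots> = real (Suc n) * M * norm (e h) * ?F ^ Suc n" by (simp add: algebra_simps)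
    finally show ?case .
  qed
  \<comment> \<open>With h = t / (n + 1) and n + 1 steps, the number of steps equals t / h. This
    turns the telescoped error into a constant times the norm of e(h) / h, which tends to 0.\<close>
  have "norm (T t x - scaleC (exp (\<mu> * t)) x) \<le>
      M * t * exp (cmod \<mu> * t) * norm (e (t / Suc n) /\<^sub>R (t / Suc n))" for n
  proof -
    have "exp (\<mu> * complex_of_real (t / Suc n)) ^ Suc n = exp (\<mu> * t)"
      "exp (cmod \<mu> * (t / Suc n)) ^ Suc n = exp (cmod \<mu> * t)"
      unfolding exp_of_nat_mult[symmetric] by (simp_all add: field_simps flip: of_nat_Suc del: of_nat_Suc)
    with step[of "t / Suc n" "Suc n"] \<open>t > 0\<close> show ?thesis
      by (simp add: field_simps del: power_Suc of_nat_Suc)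
  qed
  moreover have "(\<lambda>n. M * t * exp (cmod \<mu> * t) * norm (e (t / Suc n) /\<^sub>R (t / Suc n))) \<longlonglongrightarrow>
      M * t * exp (cmod \<mu> * t) * norm (0 :: 'a)"
  proof (intro tendsto_mult tendsto_const tendsto_norm filterlim_compose[OF lim])
    show "filterlim (\<lambda>n. t / real (Suc n)) (at_right 0) sequentially"
      unfolding filterlim_at using \<open>t > 0\<close> LIMSEQ_Suc[OF lim_const_over_n[of t]]
      by (auto intro!: always_eventually)
  qed
  ultimately have "norm (T t x - scaleC (exp (\<mu> * t)) x) \<le> M * t * exp (cmod \<mu> * t) * norm (0 :: 'a)"
    by (meson LIMSEQ_le_const)
  then show ?thesis by simp
qed

lemma exponential_growth_exponent_le:
  assumes "M > 0" and le: "\<And>t. t \<ge> 0 \<Longrightarrow> exp (r * t) \<le> M * exp (s * t)"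
  shows "r \<le> (s::real)"
proof (rule ccontr)
  assume "\<not> r \<le> s"
  then have "r - s > 0" by simp
  \<comment> \<open>The time M / (r - s) makes the left side 1 + M, while the hypothesis bounds the
    exponential by \<open>M\<close>.\<close>
  have "1 + (r - s) * (M / (r - s)) \<le> exp ((r - s) * (M / (r - s)))"
    by (rule exp_ge_add_one_self)
  also have "\<dots> \<le> M"
  proof -
    have "exp ((r - s) * u) * exp (s * u) = exp (r * u)" for u
      unfolding exp_add[symmetric] by (simp add: algebra_simps)
    then have "exp ((r - s) * (M / (r - s))) * exp (s * (M / (r - s))) = exp (r * (M / (r - s)))" .
    also have "\<dots> \<le> M * exp (s * (M / (r - s)))"
      using \<open>M > 0\<close> \<open>r - s > 0\<close> by (intro le) simp
    finally show ?thesis by simp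
  qed
  finally show False using \<open>r - s > 0\<close> by simp
qed

section \<open>Eigenvalues of analytic semigroups\<close>

lemma ball_subset_sector:
  assumes "\<delta> > 0"
  obtains r where "r > 0" "ball 1 r \<subseteq> sector \<delta>"
proof -
  have "(1::complex) \<notin> \<real>\<^sub>\<le>\<^sub>0" by simp
  from continuous_at_Arg[OF this] have "(Arg \<longlongrightarrow> 0) (at 1)"
    unfolding continuous_at by simp
  then obtain d where "d > 0" and d: "\<And>z. z \<noteq> 1 \<Longrightarrow> dist z 1 < d \<Longrightarrow> \<bar>Arg z\<bar> < \<delta>"
    using tendstoD[OF _ \<open>\<delta> > 0\<close>, of Arg 0 "at 1"] by (auto simp: eventually_at dist_real_def)
  \<comment> \<open>Radius at most 1 keeps out the origin, which a sector does not contain.\<close>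
  have "z \<in> sector \<delta>" if "z \<in> ball 1 (min d 1)" for z
  proof (cases "z = 1")
    case False
    then show ?thesis using that d[of z] by (auto simp: sector_def dist_commute)
  qed (use assms in \<open>simp add: sector_def\<close>)
  then show ?thesis using \<open>d > 0\<close> by (intro that[of "min d 1"]) auto
qed

text \<open>Prepares the identity theorem, which is about scalar functions. The derivative is
  \<open>f (L x)\<close>: the error of the scalar quotient is at most the operator-norm error times
  |x| times the bound of \<open>f\<close>.\<close>

lemma operator_norm_holomorphic_apply:
  fixes S :: "complex \<Rightarrow> 'a::cbanach \<Rightarrow> 'a" and f :: "'a \<Rightarrow> complex"
  assumes "open V" and S: "\<And>z. z \<in> V \<Longrightarrow> bounded_clinear (S z)"
    and deriv: "\<And>z. z \<in> V \<Longrightarrow> \<exists>L. bounded_clinear L \<and>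
       ((\<lambda>h. onorm (\<lambda>x. scaleC (inverse h) (S (z + h) x - S z x) - L x)) \<longlongrightarrow> 0) (at 0)"
    and f: "bounded_linear f" "\<And>c x. f (scaleC c x) = c * f x"
  shows "(\<lambda>z. f (S z x)) holomorphic_on V"
proof -
  interpret f: bounded_linear f by (rule f)
  obtain K where K: "\<And>y. cmod (f y) \<le> norm y * K" and "K \<ge> 0" using f.nonneg_bounded by blast
  have "(\<lambda>z. f (S z x)) field_differentiable at z" if "z \<in> V" for z
  proof -
    obtain L where L: "bounded_clinear L"
      and lim: "((\<lambda>h. onorm (\<lambda>x. scaleC (inverse h) (S (z + h) x - S z x) - L x)) \<longlongrightarrow> 0) (at 0)"
      using deriv[OF \<open>z \<in> V\<close>] by blast
    from \<open>open V\<close> \<open>z \<in> V\<close> obtain r where "r > 0" "ball z r \<subseteq> V" by (auto simp: open_contains_ball)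
    have "((\<lambda>h. (f (S (z + h) x) - f (S z x)) / h) \<longlongrightarrow> f (L x)) (at 0)"
    proof (rule LIM_zero_cancel, rule Lim_null_comparison)
      show "\<forall>\<^sub>F h in at 0. norm ((f (S (z + h) x) - f (S z x)) / h - f (L x)) \<le>
          onorm (\<lambda>x. scaleC (inverse h) (S (z + h) x - S z x) - L x) * norm x * K"
        unfolding eventually_at
      proof (intro exI[of _ r] conjI ballI impI \<open>r > 0\<close>)
        fix h :: complex assume "h \<noteq> 0 \<and> dist h 0 < r"
        then have "z + h \<in> V" using \<open>ball z r \<subseteq> V\<close> by (auto simp: dist_norm)
        let ?D = "\<lambda>x. scaleC (inverse h) (S (z + h) x - S z x) - L x"
        have D: "bounded_linear ?D"
          using S[OF \<open>z + h \<in> V\<close>] S[OF \<open>z \<in> V\<close>] L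
          by (intro bounded_linear_sub bounded_clinearD bounded_linear_compose[OF bounded_linear_scaleC_right])
        have "(f (S (z + h) x) - f (S z x)) / h - f (L x) = f (?D x)"
          by (simp add: f.diff f(2) divide_inverse mult.commute)
        then have "norm ((f (S (z + h) x) - f (S z x)) / h - f (L x)) \<le> norm (?D x) * K"
          using K by simp
        also have "\<dots> \<le> onorm ?D * norm x * K"
          using onorm[OF D] \<open>K \<ge> 0\<close> by (rule mult_right_mono)
        finally show "norm ((f (S (z + h) x) - f (S z x)) / h - f (L x)) \<le> onorm ?D * norm x * K" .
      qed
      show "((\<lambda>h. onorm (\<lambda>x. scaleC (inverse h) (S (z + h) x - S z x) - L x) * norm x * K) \<longlongrightarrow> 0) (at 0)"
        using tendsto_mult_left_zero[OF tendsto_mult_left_zero[OF lim]] by simp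
    qed
    then show ?thesis unfolding field_differentiable_def DERIV_def by blast
  qed
  then show ?thesis
    by (meson field_differentiable_at_within holomorphic_onI)
qed

text \<open>Since S(z) x = exp (\<mu> z) x near z = 1, the norm of S(z) bounds exp (Re (\<mu> z)).
  At z = 1 + is and z = 1 - is this limits Re \<mu> - s Im \<mu> and Re \<mu> + s Im \<mu> by one
  constant. The constants depend on \<open>T\<close> alone and so serve all eigenvalues
  simultaneously.\<close>

lemma (in riesz_basis) analytic_semigroup_eigenvalue_bound:
  fixes T :: "real \<Rightarrow> 'a \<Rightarrow> 'a"
  assumes T: "analytic_semigroup T"
  obtains r K where "r > 0"
    and "\<And>x \<mu>. x \<noteq> 0 \<Longrightarrow> (\<And>t. t \<ge> 0 \<Longrightarrow> T t x = scaleC (exp (\<mu> * complex_of_real t)) x) \<Longrightarrow>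
           r * \<bar>Im \<mu>\<bar> \<le> K - Re \<mu>"
proof -
  from T obtain \<delta> S where "0 < \<delta>" and ST: "\<And>t. t \<ge> 0 \<Longrightarrow> S (complex_of_real t) = T t"
    and S: "\<And>z. z \<in> sector \<delta> \<Longrightarrow> bounded_clinear (S z)"
    and deriv: "\<And>z. z \<in> sector \<delta> \<Longrightarrow> \<exists>L. bounded_clinear L \<and>
       ((\<lambda>h. onorm (\<lambda>x. scaleC (inverse h) (S (z + h) x - S z x) - L x)) \<longlongrightarrow> 0) (at 0)"
    unfolding analytic_semigroup_def by blast
  obtain r where "r > 0" and r: "ball 1 r \<subseteq> sector \<delta>" using ball_subset_sector[OF \<open>0 < \<delta>\<close>] .
  define s where "s = min r 1 / 2"
  have "s > 0" using \<open>r > 0\<close> by (simp add: s_def)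
  let ?p = "Complex 1 s" and ?m = "Complex 1 (- s)"
  have pm: "?p \<in> ball 1 r" "?m \<in> ball 1 r"
    using \<open>r > 0\<close> by (auto simp: dist_norm cmod_def s_def complex_eq_iff)
  \<comment> \<open>The 1 guarantees that \<open>ln N\<close> is taken of a positive number.\<close>
  define N where "N = max 1 (max (onorm (S ?p)) (onorm (S ?m)))"
  have "s * \<bar>Im \<mu>\<bar> \<le> ln N - Re \<mu>"
    if "x \<noteq> 0" and eig: "\<And>t. t \<ge> 0 \<Longrightarrow> T t x = scaleC (exp (\<mu> * complex_of_real t)) x" for x \<mu>
  proof -
    \<comment> \<open>Identity theorem in each coordinate: on the real segment (1, 1 + r), which
      accumulates at 1, the extension agrees with \<open>T\<close>, and there the claim is the
      eigenvector hypothesis.\<close>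
    have Sx: "S z x = scaleC (exp (\<mu> * z)) x" if "z \<in> ball 1 r" for z
    proof (rule eq_if_coord_eq)
      fix k
      let ?g = "\<lambda>z. coord (S z x) k - exp (\<mu> * z) * coord x k"
      have "?g z = 0"
      proof (rule analytic_continuation[of ?g "ball 1 r" "complex_of_real ` {1<..<1+r}" 1 z])
        show "?g holomorphic_on ball 1 r"
          using r by (intro holomorphic_intros operator_norm_holomorphic_apply S deriv
              bounded_linear_coord coord_scaleC) auto
        show "complex_of_real ` {1<..<1+r} \<subseteq> ball 1 r"
        proof
          fix w assume "w \<in> complex_of_real ` {1<..<1+r}"
          then obtain q where q: "w = complex_of_real q" "1 < q" "q < 1 + r" by auto
          have "dist 1 w = \<bar>1 - q\<bar>"
            unfolding q(1) dist_norm by (metis norm_of_real of_real_1 of_real_diff)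
          with q show "w \<in> ball 1 r" by simp
        qed
        show "1 islimpt complex_of_real ` {1<..<1+r}"
          unfolding islimpt_approachable
        proof (intro allI impI)
          fix e :: real assume "e > 0"
          define q where "q = min (e / 2) (r / 2)"
          have "0 < q" "q < e" "q < r" using \<open>e > 0\<close> \<open>r > 0\<close> by (auto simp: q_def)
          then show "\<exists>x'\<in>complex_of_real ` {1<..<1+r}. x' \<noteq> 1 \<and> dist x' 1 < e"
            by (intro bexI[of _ "complex_of_real (1 + q)"] imageI) (auto simp: dist_norm)
        qed
        show "?g w = 0" if "w \<in> complex_of_real ` {1<..<1+r}" for w
          using that by (auto simp: ST eig coord_scaleC)
      qed (use that \<open>r > 0\<close> in auto)
      then show "coord (S z x) k = coord (scaleC (exp (\<mu> * z)) x) k"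
        by (simp add: coord_scaleC)
    qed
    have le: "Re (\<mu> * z) \<le> ln N" if "z \<in> ball 1 r" "onorm (S z) \<le> N" for z
    proof -
      have "cmod (exp (\<mu> * z)) * norm x = norm (S z x)"
        by (simp add: Sx[OF that(1)] norm_scaleC)
      also have "\<dots> \<le> onorm (S z) * norm x"
        using S r that by (intro onorm bounded_clinearD) auto
      also have "\<dots> \<le> N * norm x" using that(2) by (rule mult_right_mono) simp
      finally have "exp (Re (\<mu> * z)) \<le> N" using \<open>x \<noteq> 0\<close> by (simp add: norm_exp_eq_Re)
      then show ?thesis by (subst ln_ge_iff) (auto simp: N_def)
    qed
    have "Re \<mu> - s * Im \<mu> \<le> ln N" "Re \<mu> + s * Im \<mu> \<le> ln N"
      using le[OF pm(1)] le[OF pm(2)] by (auto simp: N_def algebra_simps)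
    then show ?thesis using \<open>s > 0\<close> by (cases "Im \<mu> \<ge> 0") auto
  qed
  with \<open>s > 0\<close> show ?thesis by (rule that)
qed

section \<open>Essentially bounded inputs\<close>

lemma AE_lebesgue_on_iff:
  "S \<in> sets lebesgue \<Longrightarrow> (AE s in lebesgue_on S. P s) \<longleftrightarrow> (AE s in lebesgue. s \<in> S \<longrightarrow> P s)"
  by (rule AE_restrict_space_iff) simp

text \<open>On a space of measure 0 the essential supremum of a measurable function is minus
  infinity, so the positive measure of the half line has to be used. Nonnegativity ensures that
  \<open>real_of_ereal\<close> in \<open>Linf_norm\<close> loses nothing for members of
  \<open>Linf\<close>.\<close>

lemma esssup_norm_nonneg:
  fixes u :: "real \<Rightarrow> 'u::real_normed_vector"
  shows "0 \<le> esssup (lebesgue_on {0..}) (\<lambda>s. ereal (norm (u s)))"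
proof (rule ccontr)
  assume "\<not> ?thesis"
  then have neg: "esssup (lebesgue_on {0..}) (\<lambda>s. ereal (norm (u s))) < 0" by simp
  have "AE s in lebesgue_on {0..}.
      ereal (norm (u s)) \<le> esssup (lebesgue_on {0..}) (\<lambda>s. ereal (norm (u s)))"
    by (rule esssup_AE)
  then have "AE s in lebesgue_on {0..}. ereal (norm (u s)) < 0"
    by (rule eventually_mono) (rule order_le_less_trans[OF _ neg])
  then have "AE s in lebesgue. s \<notin> {0::real..}"
    by (simp add: AE_lebesgue_on_iff)
  then have "emeasure lebesgue {0::real..} = 0"
    by (subst (asm) AE_iff_null_sets[symmetric]) auto
  moreover have "emeasure lebesgue {0::real..1} \<le> emeasure lebesgue {0::real..}"
    by (rule emeasure_mono) auto
  ultimately show False by simp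
qed

lemma LinfI:
  fixes u :: "real \<Rightarrow> 'u::real_normed_vector"
  assumes u: "u \<in> borel_measurable (lebesgue_on {0..})"
    and le: "AE s in lebesgue_on {0..}. norm (u s) \<le> K"
  shows "u \<in> Linf" and "Linf_norm u \<le> K"
proof -
  let ?e = "esssup (lebesgue_on {0..}) (\<lambda>s. ereal (norm (u s)))"
  have "?e \<le> ereal K"
    using u le by (intro esssup_I) auto
  then show "u \<in> Linf"
    using u le_less_trans[of ?e "ereal K" \<infinity>] by (auto simp: Linf_def)
  show "Linf_norm u \<le> K"
    using \<open>?e \<le> ereal K\<close> esssup_norm_nonneg[of u] unfolding Linf_norm_def
    by (cases ?e) auto
qed

lemma LinfD:
  fixes u :: "real \<Rightarrow> 'u::real_normed_vector"
  assumes "u \<in> Linf"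
  shows "u \<in> borel_measurable (lebesgue_on {0..})"
    and "AE s in lebesgue_on {0..}. norm (u s) \<le> Linf_norm u"
    and "0 \<le> Linf_norm u"
proof -
  let ?e = "esssup (lebesgue_on {0..}) (\<lambda>s. ereal (norm (u s)))"
  show "u \<in> borel_measurable (lebesgue_on {0..})" using assms by (simp add: Linf_def)
  have "?e < \<infinity>" using assms by (simp add: Linf_def)
  with esssup_norm_nonneg[of u] have e: "?e = ereal (Linf_norm u)"
    unfolding Linf_norm_def by (cases ?e) auto
  show "AE s in lebesgue_on {0..}. norm (u s) \<le> Linf_norm u"
    using esssup_AE[where M="lebesgue_on {0..}" and f="\<lambda>s. ereal (norm (u s))"] by (simp add: e)
  show "0 \<le> Linf_norm u"
    using esssup_norm_nonneg[of u] e by simp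
qed

lemma Linf_bounded_linear:
  assumes "u \<in> Linf" and g: "bounded_linear g" "\<And>x. norm (g x) \<le> K * norm x" and "K \<ge> 0"
  shows "(\<lambda>s. g (u s)) \<in> Linf" and "Linf_norm (\<lambda>s. g (u s)) \<le> K * Linf_norm u"
proof -
  have "g \<in> borel_measurable borel"
    by (intro borel_measurable_continuous_onI linear_continuous_on g)
  then have meas: "(\<lambda>s. g (u s)) \<in> borel_measurable (lebesgue_on {0..})"
    using LinfD(1)[OF assms(1)] by (rule measurable_compose[rotated])
  have le: "AE s in lebesgue_on {0..}. norm (g (u s)) \<le> K * Linf_norm u"
    using LinfD(2)[OF assms(1)]
    by eventually_elim (metis g(2) mult_left_mono order_trans \<open>K \<ge> 0\<close>)
  show "(\<lambda>s. g (u s)) \<in> Linf" "Linf_norm (\<lambda>s. g (u s)) \<le> K * Linf_norm u"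
    using LinfI[OF meas le] by auto
qed

text \<open>Translation invariance of Lebesgue measure, read off the affine change of variables with
  factor 1, whose density is constantly 1.\<close>

lemma AE_lebesgue_shift:
  assumes "AE s in lebesgue. P s"
  shows "AE s in lebesgue. P (t + s :: real)"
proof (rule AE_distrD[where f="(+) t" and M'=lebesgue and P=P])
  show "(+) t \<in> lebesgue \<rightarrow>\<^sub>M lebesgue"
    using lebesgue_affine_measurable[of "\<lambda>_. 1" t] by simp
  have "lebesgue = density (distr lebesgue lebesgue ((+) t)) (\<lambda>_. 1)"
    using lebesgue_real_affine[of 1 t] by simp
  then have "lebesgue = distr lebesgue lebesgue ((+) t)" by (simp add: density_1)
  with assms show "AE s in distr lebesgue lebesgue ((+) t). P s" by metis
qed

lemma Linf_shift:
  assumes u: "u \<in> Linf" and "t \<ge> 0"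
  shows "(\<lambda>s. u (t + s)) \<in> Linf" and "Linf_norm (\<lambda>s. u (t + s)) \<le> Linf_norm u"
proof -
  have "(+) t \<in> lebesgue_on {0..} \<rightarrow>\<^sub>M lebesgue_on {0..}"
    using lebesgue_affine_measurable[of "\<lambda>_. 1" t] \<open>t \<ge> 0\<close>
    by (intro measurable_restrict_space3) auto
  then have meas: "(\<lambda>s. u (t + s)) \<in> borel_measurable (lebesgue_on {0..})"
    using LinfD(1)[OF u] by (rule measurable_compose)
  have "AE s in lebesgue. s \<in> {0..} \<longrightarrow> norm (u s) \<le> Linf_norm u"
    using LinfD(2)[OF u] by (simp add: AE_lebesgue_on_iff)
  from AE_lebesgue_shift[OF this, of t]
  have le: "AE s in lebesgue_on {0..}. norm (u (t + s)) \<le> Linf_norm u"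
    using \<open>t \<ge> 0\<close> by (auto simp: AE_lebesgue_on_iff elim!: eventually_mono)
  show "(\<lambda>s. u (t + s)) \<in> Linf" "Linf_norm (\<lambda>s. u (t + s)) \<le> Linf_norm u"
    using LinfI[OF meas le] by auto
qed

lemma Linf_concat:
  assumes u: "u \<in> Linf" and v: "v \<in> Linf" and "t > 0"
  shows "(\<lambda>s. if s \<le> t then u s else v (s - t)) \<in> Linf"
proof (rule LinfI)
  let ?w = "\<lambda>s. if s \<le> t then u s else v (s - t)"
  have v': "(\<lambda>s. v (s - t)) \<in> borel_measurable (lebesgue_on {t..})"
  proof (rule measurable_compose[OF _ LinfD(1)[OF v]])
    show "(\<lambda>s. s - t) \<in> lebesgue_on {t..} \<rightarrow>\<^sub>M lebesgue_on {0..}"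
      using lebesgue_affine_measurable[of "\<lambda>_. 1" "- t"]
      by (intro measurable_restrict_space3) auto
  qed
  show "?w \<in> borel_measurable (lebesgue_on {0..})"
  \<comment> \<open>Nothing is known about \<open>v\<close> at negative arguments, so
    \<open>v (s - t)\<close> can be treated only on its own piece s > t.\<close>
  proof (rule measurable_If_restrict_space_iff[THEN iffD2])
    show "{s \<in> space (lebesgue_on {0..}). s \<le> t} \<in> sets (lebesgue_on {0..})"
      by (auto simp: sets_restrict_space_iff space_restrict_space)
    have "{0..} \<inter> {s. s \<le> t} \<subseteq> {0..}" "{0..} \<inter> {s. \<not> s \<le> t} \<subseteq> {t..}" by auto
    then show "u \<in> borel_measurable (restrict_space (lebesgue_on {0..}) {s. s \<le> t}) \<and>
        (\<lambda>s. v (s - t)) \<in> borel_measurable (restrict_space (lebesgue_on {0..}) {s. \<not> s \<le> t})"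
      using LinfD(1)[OF u] v' by (auto simp: restrict_restrict_space intro: measurable_restrict_mono)
  qed
  have "AE s in lebesgue. s \<in> {0..} \<longrightarrow> norm (u s) \<le> Linf_norm u"
    using LinfD(2)[OF u] by (simp add: AE_lebesgue_on_iff)
  moreover have "AE s in lebesgue. - t + s \<in> {0..} \<longrightarrow> norm (v (- t + s)) \<le> Linf_norm v"
    using LinfD(2)[OF v] by (intro AE_lebesgue_shift) (simp add: AE_lebesgue_on_iff)
  ultimately have "AE s in lebesgue. s \<in> {0..} \<longrightarrow> norm (?w s) \<le> max (Linf_norm u) (Linf_norm v)"
    by eventually_elim auto
  then show "AE s in lebesgue_on {0..}. norm (?w s) \<le> max (Linf_norm u) (Linf_norm v)"
    by (simp add: AE_lebesgue_on_iff)
qed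

text \<open>An abstract product covers two uses: complex multiplication with an exponential, and
  \<open>scaleC\<close> acting on an orbit in X_-1. In both, an essentially bounded function on a
  finite measure space is integrated.\<close>

lemma Linf_set_integrable:
  fixes prod :: "complex \<Rightarrow> 'b::{real_normed_vector, second_countable_topology}
    \<Rightarrow> 'c::{banach, second_countable_topology}"
  assumes prod: "bounded_bilinear prod" and f: "f \<in> Linf" and g: "continuous_on {0..t} g"
  shows "set_integrable lebesgue {0..t} (\<lambda>s. prod (f s) (g s))"
proof -
  interpret bounded_bilinear prod by (rule prod)
  obtain K where "K \<ge> 0" and K: "\<And>a b. norm (prod a b) \<le> norm a * norm b * K"
    using nonneg_bounded by blast
  obtain G where "\<forall>y\<in>g ` {0..t}. norm y \<le> G"
    using compact_imp_bounded[OF compact_continuous_image[OF g compact_Icc]]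
    unfolding bounded_iff by blast
  then have G: "norm (g s) \<le> G" if "s \<in> {0..t}" for s using that by blast
  have "f \<in> borel_measurable (lebesgue_on {0..t})"
    using LinfD(1)[OF f] by (rule measurable_restrict_mono) auto
  moreover have "g \<in> borel_measurable (lebesgue_on {0..t})"
    using continuous_imp_measurable_on_sets_lebesgue[OF g] by simp
  ultimately have meas: "(\<lambda>s. prod (f s) (g s)) \<in> borel_measurable (lebesgue_on {0..t})"
    by (rule borel_measurable_continuous_Pair)
       (intro continuous_on continuous_on_fst continuous_on_snd continuous_on_id)
  have "AE s in lebesgue. s \<in> {0..} \<longrightarrow> cmod (f s) \<le> Linf_norm f"
    using LinfD(2)[OF f] by (simp add: AE_lebesgue_on_iff)
  then have "AE s in lebesgue. s \<in> {0..t} \<longrightarrow> norm (prod (f s) (g s)) \<le> Linf_norm f * G * K"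
  proof eventually_elim
    case (elim s)
    show ?case
    proof
      assume s: "s \<in> {0..t}"
      have "norm (prod (f s) (g s)) \<le> norm (f s) * norm (g s) * K" by (rule K)
      also have "\<dots> \<le> Linf_norm f * G * K"
        using s elim G[OF s] \<open>K \<ge> 0\<close> by (intro mult_right_mono mult_mono) (auto intro: order_trans[OF norm_ge_zero])
      finally show "norm (prod (f s) (g s)) \<le> Linf_norm f * G * K" .
    qed
  qed
  then have "AE s in lebesgue_on {0..t}. norm (prod (f s) (g s)) \<le> Linf_norm f * G * K"
    by (simp add: AE_lebesgue_on_iff)
  then have "integrable (lebesgue_on {0..t}) (\<lambda>s. prod (f s) (g s))"
    using meas by (intro finite_measure.integrable_const_bound finite_measure_lebesgue_on) auto
  then show ?thesis
    unfolding set_integrable_def by (subst (asm) integrable_restrict_space) auto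
qed

section \<open>Convolution with an exponential\<close>

text \<open>The solution at time \<open>t\<close> of v' = \<mu> v + f, v(0) = 0, which is the system
  as seen by one coordinate. For t < 0 the interval is empty and the value is 0.\<close>

definition exp_convolution :: "complex \<Rightarrow> (real \<Rightarrow> complex) \<Rightarrow> real \<Rightarrow> complex" where
  "exp_convolution \<mu> f t = (LINT s:{0..t}|lebesgue. f s * exp (\<mu> * complex_of_real (t - s)))"

text \<open>The time \<open>r\<close> in the kernel is kept apart from the end \<open>t\<close> of
  the interval because the continuity proof takes r = 0.\<close>

lemma exp_convolution_integrable:
  assumes "f \<in> Linf"
  shows "set_integrable lebesgue {0..t} (\<lambda>s. f s * exp (\<mu> * complex_of_real (r - s)))"
  by (intro Linf_set_integrable bounded_bilinear_mult assms continuous_intros)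

lemma exp_convolution_cong_AE:
  assumes "f \<in> Linf" "g \<in> Linf" and eq: "AE s in lebesgue_on {0..t}. f s = g s"
  shows "exp_convolution \<mu> f t = exp_convolution \<mu> g t"
  unfolding exp_convolution_def set_lebesgue_integral_def
proof (rule integral_cong_AE)
  show "AE s in lebesgue. indicat_real {0..t} s *\<^sub>R (f s * exp (\<mu> * complex_of_real (t - s))) =
      indicat_real {0..t} s *\<^sub>R (g s * exp (\<mu> * complex_of_real (t - s)))"
    using eq by (auto simp: AE_lebesgue_on_iff indicator_def elim!: eventually_mono)
qed (use exp_convolution_integrable assms(1,2) in \<open>auto simp: set_integrable_def intro!: borel_measurable_integrable\<close>)

lemma exp_convolution_eq_integral:
  assumes "f \<in> Linf"
  shows "exp_convolution \<mu> f t = integral {0..t} (\<lambda>s. f s * exp (\<mu> * complex_of_real (t - s)))"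
  unfolding exp_convolution_def
  by (intro set_lebesgue_integral_eq_integral exp_convolution_integrable assms)

text \<open>1 / |Re \<mu>| is the L_1 norm of the kernel on the half line. The bound does not depend
  on \<open>t\<close>, which is what later makes the input gain uniform in time.\<close>

lemma exp_convolution_bound:
  assumes f: "f \<in> Linf" and "Re \<mu> < 0"
  shows "cmod (exp_convolution \<mu> f t) \<le> Linf_norm f / \<bar>Re \<mu>\<bar>"
proof (cases "t \<ge> 0")
  case True
  let ?r = "Re \<mu>" and ?L = "Linf_norm f"
  have int: "((\<lambda>s. ?L * exp (?r * (t - s))) has_integral
      (?L * exp (?r * (t - t)) / (- ?r) - ?L * exp (?r * (t - 0)) / (- ?r))) {0..t}"
    using True \<open>Re \<mu> < 0\<close>
    by (intro fundamental_theorem_of_calculus)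
       (auto intro!: derivative_eq_intros simp flip: has_real_derivative_iff_has_vector_derivative)
  have aint: "set_integrable lebesgue {0..t} (\<lambda>s. ?L * exp (?r * (t - s)))"
    by (intro absolutely_integrable_continuous_real continuous_intros)
  have "cmod (exp_convolution \<mu> f t) \<le>
      (LINT s:{0..t}|lebesgue. cmod (f s * exp (\<mu> * complex_of_real (t - s))))"
    unfolding exp_convolution_def by (intro set_integral_norm_bound exp_convolution_integrable f)
  also have "\<dots> \<le> (LINT s:{0..t}|lebesgue. ?L * exp (?r * (t - s)))"
  proof (rule set_integral_mono_AE)
    show "set_integrable lebesgue {0..t} (\<lambda>s. cmod (f s * exp (\<mu> * complex_of_real (t - s))))"
      by (intro set_integrable_norm exp_convolution_integrable f)
    have "AE s in lebesgue. s \<in> {0..} \<longrightarrow> cmod (f s) \<le> ?L"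
      using LinfD(2)[OF f] by (simp add: AE_lebesgue_on_iff)
    then show "AE s\<in>{0..t} in lebesgue. cmod (f s * exp (\<mu> * complex_of_real (t - s))) \<le> ?L * exp (?r * (t - s))"
      by eventually_elim (auto simp: norm_mult norm_exp_eq_Re intro!: mult_right_mono)
  qed (rule aint)
  also have "\<dots> = ?L * (1 - exp (?r * t)) / (- ?r)"
    unfolding set_lebesgue_integral_eq_integral(2)[OF aint] integral_unique[OF int]
    using \<open>Re \<mu> < 0\<close> by (simp add: field_simps)
  also have "\<dots> \<le> ?L / (- ?r)"
    using \<open>Re \<mu> < 0\<close> LinfD(3)[OF f] by (intro divide_right_mono mult_left_le) auto
  finally show ?thesis using \<open>Re \<mu> < 0\<close> by simp
next
  case False
  then show ?thesis using LinfD(3)[OF f] by (simp add: exp_convolution_def set_lebesgue_integral_def)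
qed

lemma exp_convolution_continuous:
  assumes f: "f \<in> Linf"
  shows "continuous_on {0..} (exp_convolution \<mu> f)"
proof -
  let ?h = "\<lambda>s. f s * exp (\<mu> * complex_of_real (0 - s))"
  \<comment> \<open>Pulling out exp (\<mu> t) leaves an indefinite integral whose integrand does not
    depend on \<open>t\<close>.\<close>
  have eq: "exp_convolution \<mu> f t = exp (\<mu> * complex_of_real t) * integral {0..t} ?h" for t
  proof -
    have "f s * exp (\<mu> * complex_of_real (t - s)) = exp (\<mu> * complex_of_real t) * ?h s" for s
      by (simp add: right_diff_distrib exp_diff exp_minus divide_inverse mult_ac)
    then show ?thesis unfolding exp_convolution_eq_integral[OF f] by (simp only: integral_mult_right)
  qed
  have int: "?h integrable_on {0..N}" for N
    by (intro set_lebesgue_integral_eq_integral(1) exp_convolution_integrable f)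
  have "continuous (at t within {0..}) (\<lambda>t. integral {0..t} ?h)" if "t \<ge> 0" for t
  proof -
    have "continuous (at t within {0..t+1}) (\<lambda>t. integral {0..t} ?h)"
      using indefinite_integral_continuous_1[OF int, of "t + 1"] that
      by (simp add: continuous_on_eq_continuous_within)
    \<comment> \<open>Continuity of indefinite integrals is available on compact intervals; being
      local, it carries over to the half line.\<close>
    moreover have "at t within {0..t+1} = at t within {0..}"
      by (rule at_within_nhd[of t "{..<t+1}"]) auto
    ultimately show ?thesis by simp
  qed
  then have "continuous_on {0..} (\<lambda>t. integral {0..t} ?h)"
    by (simp add: continuous_on_eq_continuous_within)
  then show ?thesis
    unfolding eq by (intro continuous_intros)
qed

lemma exp_convolution_cocycle:
  assumes f: "f \<in> Linf" and "t \<ge> 0" "h \<ge> 0"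
  shows "exp_convolution \<mu> f (t + h) =
    exp (\<mu> * complex_of_real h) * exp_convolution \<mu> f t + exp_convolution \<mu> (\<lambda>s. f (t + s)) h"
proof -
  let ?g = "\<lambda>s. f s * exp (\<mu> * complex_of_real (t + h - s))"
  have "exp_convolution \<mu> f (t + h) = integral {0..t+h} ?g"
    by (rule exp_convolution_eq_integral[OF f])
  also have "\<dots> = integral {0..t} ?g + integral {t..t+h} ?g"
    using \<open>t \<ge> 0\<close> \<open>h \<ge> 0\<close>
    by (intro Henstock_Kurzweil_Integration.integral_combine[symmetric]
        set_lebesgue_integral_eq_integral(1) exp_convolution_integrable f) auto
  also have "integral {0..t} ?g = exp (\<mu> * complex_of_real h) * exp_convolution \<mu> f t"
  proof -
    have "?g s = exp (\<mu> * complex_of_real h) * (f s * exp (\<mu> * complex_of_real (t - s)))" for s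
    proof -
      have "\<mu> * complex_of_real (t + h - s) = \<mu> * complex_of_real h + \<mu> * complex_of_real (t - s)"
        by (simp add: algebra_simps)
      then show ?thesis by (simp add: exp_add)
    qed
    then show ?thesis unfolding exp_convolution_eq_integral[OF f] by (simp only: integral_mult_right)
  qed
  also have "integral {t..t+h} ?g = exp_convolution \<mu> (\<lambda>s. f (t + s)) h"
    using integral_shift_Icc_real[of 0 h ?g t]
    unfolding exp_convolution_eq_integral[OF Linf_shift(1)[OF f \<open>t \<ge> 0\<close>]]
    by (simp add: o_def add.commute)
  finally show ?thesis .
qed

section \<open>The extrapolation space\<close>

lemma resolvent_apply:
  assumes "a \<in> resolvent_set D A"
  shows "resolvent D A a x \<in> D"
    and "A (resolvent D A a x) = scaleC a (resolvent D A a x) - x"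
    and "bounded_clinear (resolvent D A a)"
    and "y \<in> D \<Longrightarrow> resolvent D A a (scaleC a y - A y) = y"
    and "inj (resolvent D A a)"
proof -
  let ?f = "\<lambda>x. scaleC a x - A x"
  have bij: "bij_betw ?f D UNIV" and bd: "bounded_clinear (resolvent D A a)"
    using assms by (auto simp: resolvent_set_def)
  then show "bounded_clinear (resolvent D A a)" by simp
  have inj: "inj_on ?f D" and surj: "?f ` D = UNIV"
    using bij by (auto simp: bij_betw_def)
  show "resolvent D A a x \<in> D" for x
    unfolding resolvent_def using the_inv_into_into[OF inj, of x D] surj by auto
  have f: "?f (resolvent D A a x) = x" for x
    unfolding resolvent_def using f_the_inv_into_f[OF inj, of x] surj by auto
  then show "A (resolvent D A a x) = scaleC a (resolvent D A a x) - x"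
    by (metis add_diff_cancel_left' diff_add_cancel)
  show "resolvent D A a (scaleC a y - A y) = y" if "y \<in> D"
    unfolding resolvent_def using the_inv_into_f_f[OF inj that] .
  show "inj (resolvent D A a)" by (rule injI) (metis f)
qed

text \<open>By the choice of the norm, j x |-> R x (R the resolvent) is an isometry on the dense
  range of \<open>j\<close>, so it extends uniquely and stays linear. The image of a complete space
  under an isometry is closed; as it contains the dense range of R, it is everything.\<close>

lemma extrapolation_isometry:
  fixes j :: "'x::cbanach \<Rightarrow> 'y::cbanach"
  assumes ext: "extrapolation_space a D A j"
    and dense: "closure (range (resolvent D A a)) = UNIV"
  obtains J :: "'y \<Rightarrow> 'x" where "bounded_clinear J" and "\<And>y. norm (J y) = norm y"
    and "\<And>x. J (j x) = resolvent D A a x" and "surj J"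
proof -
  let ?R = "resolvent D A a"
  have a: "a \<in> resolvent_set D A" and norm_j: "\<And>x. norm (j x) = norm (?R x)"
    and dense_j: "closure (range j) = UNIV"
    and j_add: "\<And>x y. j (x + y) = j x + j y" and j_scaleC: "\<And>c x. j (scaleC c x) = scaleC c (j x)"
    using ext unfolding extrapolation_space_def linear_scaleC_iff by auto
  have R: "bounded_linear ?R" "\<And>c x. ?R (scaleC c x) = scaleC c (?R x)"
    using resolvent_apply(3)[OF a] by (auto simp: bounded_clinear_iff)
  have j_diff: "j (x - y) = j x - j y" for x y
    by (metis add_diff_cancel diff_add_cancel j_add)
  have "inj j"
  proof (rule injI)
    fix x y assume "j x = j y"
    then have "norm (?R (x - y)) = 0" by (simp flip: norm_j add: j_diff)
    then have "?R x = ?R y" using R(1) by (simp add: linear_simps)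
    then show "x = y" using resolvent_apply(5)[OF a] by (simp add: inj_eq)
  qed
  then have inv: "inv j (j x) = x" for x by simp
  have dist: "dist (?R x) (?R y) = dist (j x) (j y)" for x y
    unfolding dist_norm using R(1) by (simp add: j_diff[symmetric] norm_j linear_simps)
  have "uniformly_continuous_on (range j) (\<lambda>y. ?R (inv j y))"
    unfolding uniformly_continuous_on_def by (auto simp: inv dist)
  then obtain J where uc: "uniformly_continuous_on (closure (range j)) J"
    and "\<And>y. y \<in> range j \<Longrightarrow> ?R (inv j y) = J y"
    by (rule uniformly_continuous_on_extension_on_closure) blast
  then have Jj: "J (j x) = ?R x" for x by (metis inv rangeI)
  have lim_J: "(\<lambda>n. J (f n)) \<longlonglongrightarrow> J y" if "f \<longlonglongrightarrow> y" for f :: "nat \<Rightarrow> 'y" and y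
    using uniformly_continuous_imp_continuous[OF uc] that unfolding dense_j
    by (metis UNIV_I continuous_on_eq_continuous_at isCont_tendsto_compose open_UNIV)
  have approx: "\<exists>f. (\<lambda>n. j (f n)) \<longlonglongrightarrow> y" for y
  proof -
    have "y \<in> closure (range j)" by (simp add: dense_j)
    then obtain g where "\<And>n. g n \<in> range j" "g \<longlonglongrightarrow> y" unfolding closure_sequential by blast
    then have "(\<lambda>n. j (inv j (g n))) \<longlonglongrightarrow> y" by (simp add: f_inv_into_f)
    then show ?thesis by (rule exI[of _ "\<lambda>n. inv j (g n)"])
  qed
  have J_add: "J (y + z) = J y + J z" for y z
  proof -
    obtain f g where f: "(\<lambda>n. j (f n)) \<longlonglongrightarrow> y" and g: "(\<lambda>n. j (g n)) \<longlonglongrightarrow> z"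
      using approx by meson
    have "(\<lambda>n. J (j (f n)) + J (j (g n))) \<longlonglongrightarrow> J (y + z)"
      using lim_J[OF tendsto_add[OF f g]] R(1) by (simp add: Jj linear_simps flip: j_add)
    moreover have "(\<lambda>n. J (j (f n)) + J (j (g n))) \<longlonglongrightarrow> J y + J z"
      by (intro tendsto_add lim_J f g)
    ultimately show ?thesis by (rule LIMSEQ_unique)
  qed
  have J_scaleC: "J (scaleC c y) = scaleC c (J y)" for c y
  proof -
    obtain f where f: "(\<lambda>n. j (f n)) \<longlonglongrightarrow> y" using approx by meson
    have "(\<lambda>n. scaleC c (J (j (f n)))) \<longlonglongrightarrow> J (scaleC c y)"
      using lim_J[OF bounded_linear.tendsto[OF bounded_linear_scaleC_right f, of c]]
      by (simp add: Jj R(2) flip: j_scaleC)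
    moreover have "(\<lambda>n. scaleC c (J (j (f n)))) \<longlonglongrightarrow> scaleC c (J y)"
      by (intro bounded_linear.tendsto[OF bounded_linear_scaleC_right] lim_J f)
    ultimately show ?thesis by (rule LIMSEQ_unique)
  qed
  have J_norm: "norm (J y) = norm y" for y
  proof -
    obtain f where f: "(\<lambda>n. j (f n)) \<longlonglongrightarrow> y" using approx by meson
    have "(\<lambda>n. norm (j (f n))) \<longlonglongrightarrow> norm (J y)"
      using tendsto_norm[OF lim_J[OF f]] by (simp add: Jj norm_j)
    then show ?thesis using tendsto_norm[OF f] LIMSEQ_unique by blast
  qed
  have J: "bounded_clinear J"
    unfolding bounded_clinear_iff
    by (intro conjI allI bounded_linear_intro[where K=1])
       (simp_all add: J_add J_scaleC J_norm scaleR_scaleC)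
  have "complete (range J)"
    using J_norm bounded_clinearD[OF J]
    by (intro complete_isometric_image[where e=1]) (auto simp: complete_UNIV)
  then have "closure (range J) = range J" by (simp add: complete_imp_closed)
  moreover have "range ?R \<subseteq> range J" using Jj by (metis image_subsetI rangeI)
  ultimately have "surj J" using dense closure_mono[of "range ?R" "range J"] by auto
  with J J_norm Jj show ?thesis by (rule that)
qed

lemma gen_eqI: "((\<lambda>h. (T h x - x) /\<^sub>R h) \<longlongrightarrow> y) (at_right 0) \<Longrightarrow> gen T x = y"
  unfolding gen_def by (rule tendsto_Lim) simp_all

lemma generates_tendsto:
  assumes "generates D A T" and "x \<in> D"
  shows "((\<lambda>h. (T h x - x) /\<^sub>R h) \<longlongrightarrow> A x) (at_right 0)"
proof -
  from assms have "x \<in> gen_dom T" and A: "A x = gen T x" unfolding generates_def by auto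
  then obtain y where y: "((\<lambda>h. (T h x - x) /\<^sub>R h) \<longlongrightarrow> y) (at_right 0)" unfolding gen_dom_def by blast
  then have "gen T x = y" by (rule gen_eqI)
  with A y show ?thesis by simp
qed

text \<open>
  \<open>J\<close> is \<open>(a - A\<^sub>-\<^sub>1)\<^sup>-\<^sup>1\<close>: it conjugates the extrapolated semigroup to the original one, so the domain
  of \<open>A\<^sub>-\<^sub>1\<close> is \<open>J\<^sup>-\<^sup>1 D(A)\<close>, which contains \<open>j x\<close> for every \<open>x\<close>.
\<close>

lemma gen_extrapolated:
  fixes J :: "'y::cbanach \<Rightarrow> 'x::cbanach"
  assumes J: "bounded_linear J" "\<And>y. norm (J y) = norm y" "surj J"
    and conj: "\<And>t y. t \<ge> 0 \<Longrightarrow> J (Tm t y) = T t (J y)"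
    and gen: "generates D A T" and "J y \<in> D"
  shows "J (gen Tm y) = A (J y)"
proof -
  interpret J: bounded_linear J by (rule J)
  obtain z where z: "J z = A (J y)" using \<open>surj J\<close> by (metis surj_def)
  have "((\<lambda>h. (Tm h y - y) /\<^sub>R h) \<longlongrightarrow> z) (at_right 0)"
  \<comment> \<open>As \<open>J\<close> preserves norms, convergence of the quotients in X_-1 can be
    tested on their images in X.\<close>
  proof (rule LIM_zero_cancel, rule tendsto_norm_zero_cancel, rule Lim_transform_eventually)
    show "((\<lambda>h. norm ((T h (J y) - J y) /\<^sub>R h - A (J y))) \<longlongrightarrow> 0) (at_right 0)"
      using generates_tendsto[OF gen \<open>J y \<in> D\<close>] by (intro tendsto_norm_zero LIM_zero)
    show "\<forall>\<^sub>F h in at_right 0. norm ((T h (J y) - J y) /\<^sub>R h - A (J y)) = norm ((Tm h y - y) /\<^sub>R h - z)"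
      unfolding eventually_at_filter
      by (intro always_eventually allI impI, subst J(2)[symmetric])
         (simp add: J.diff J.scaleR conj z)
  qed
  then show ?thesis using z gen_eqI by metis
qed

section \<open>Diagonal semigroups\<close>

locale diagonal_semigroup = riesz_basis \<phi> for \<phi> :: "nat \<Rightarrow> 'a::cbanach" +
  fixes T :: "real \<Rightarrow> 'a \<Rightarrow> 'a" and ev :: "nat \<Rightarrow> complex"
  assumes T: "C0_semigroup T"
    and eigenvector: "t \<ge> 0 \<Longrightarrow> T t (\<phi> k) = scaleC (exp (ev k * complex_of_real t)) (\<phi> k)"
    and Re_ev_neg: "Re (ev k) < 0"
begin

lemma coord_T: "t \<ge> 0 \<Longrightarrow> coord (T t x) k = exp (ev k * complex_of_real t) * coord x k"
  by (rule coord_diagonal[where m="\<lambda>k. exp (ev k * complex_of_real t)"])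
     (auto intro: C0_semigroupD(1)[OF T] eigenvector)

text \<open>\<open>C0_semigroup\<close> states only right continuity at 0. Here all times are
  handled together, because the coordinates of the orbit are dominated by those of
  \<open>x\<close>.\<close>

lemma continuous_orbit: "continuous_on {0..} (\<lambda>t. T t x)"
proof (rule continuous_on_coord)
  show "continuous_on {0..} (\<lambda>t. coord (T t x) k)" for k
  proof -
    have "continuous_on {0..} (\<lambda>t. exp (ev k * complex_of_real t) * coord x k)"
      by (intro continuous_intros)
    then show ?thesis by (rule continuous_on_eq) (simp add: coord_T)
  qed
  show "cmod (coord (T t x) k) \<le> cmod (coord x k)" if "t \<in> {0..}" for t k
    using that Re_ev_neg[of k]
    by (simp add: coord_T norm_mult norm_exp_eq_Re mult_left_le_one_le mult_nonpos_nonneg)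
qed (rule coord_square_summable)

text \<open>
  For the system with input operator \<open>B = (a - A\<^sub>-\<^sub>1) C\<close> the \<open>k\<close>-th coordinate of the state reached
  from \<open>0\<close> is \<open>a - ev k\<close> times that of the convolution with \<open>C u\<close>. The latter gains a factor
  \<open>1 / Re (ev k)\<close>, so the spectrum lying in a sector makes the sequence square summable.
\<close>

lemma reachable_states:
  fixes C :: "'u::cbanach \<Rightarrow> 'a"
  assumes fin_dim: "finite_dim_space TYPE('u)" and C: "bounded_clinear C"
    and sector: "\<And>k. cmod (a - ev k) \<le> \<kappa> * \<bar>Re (ev k)\<bar>" and "\<kappa> \<ge> 0"
  obtains z K where "K > 0"
    and "\<And>t u k. u \<in> Linf \<Longrightarrow>
      coord (z t u) k = (a - ev k) * exp_convolution (ev k) (\<lambda>s. coord (C (u s)) k) t"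
    and "\<And>t u. u \<in> Linf \<Longrightarrow> norm (z t u) \<le> K * Linf_norm u"
    and "\<And>u. u \<in> Linf \<Longrightarrow> continuous_on {0..} (\<lambda>t. z t u)"
proof -
  obtain E :: "'u set" and p where "finite E" and p: "\<And>e. e \<in> E \<Longrightarrow> bounded_linear (p e)"
    and sum_p: "\<And>u. u = (\<Sum>e\<in>E. scaleC (p e u) e)"
    using finite_dim_coordinates[OF fin_dim] by blast
  have "\<exists>K\<ge>0. \<forall>u. cmod (p e u) \<le> norm u * K" if "e \<in> E" for e
    using bounded_linear.nonneg_bounded[OF p[OF that]] .
  then obtain N where N: "\<And>e u. e \<in> E \<Longrightarrow> N e \<ge> 0 \<and> cmod (p e u) \<le> norm u * N e" by metis
  define \<gamma> where "\<gamma> k = (\<Sum>e\<in>E. N e * cmod (coord (C e) k))" for k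
  have "\<gamma> k \<ge> 0" for k unfolding \<gamma>_def using N by (intro sum_nonneg mult_nonneg_nonneg) auto
  have coord_C: "cmod (coord (C u) k) \<le> \<gamma> k * norm u" for u k
  proof -
    have "linear (\<lambda>u. coord (C u) k)"
      using bounded_linear_compose[OF bounded_linear_coord bounded_clinearD[OF C]]
      by (rule bounded_linear.linear)
    then have "coord (C u) k = (\<Sum>e\<in>E. coord (C (scaleC (p e u) e)) k)"
      by (subst sum_p[of u]) (rule linear_sum)
    also have "\<dots> = (\<Sum>e\<in>E. p e u * coord (C e) k)"
      by (simp add: bounded_clinear_scaleC[OF C] coord_scaleC)
    also have "cmod \<dots> \<le> (\<Sum>e\<in>E. cmod (p e u) * cmod (coord (C e) k))"
      by (rule order_trans[OF norm_sum]) (simp add: norm_mult)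
    also have "\<dots> \<le> (\<Sum>e\<in>E. norm u * N e * cmod (coord (C e) k))"
      using N by (intro sum_mono mult_right_mono) auto
    finally show ?thesis by (simp add: \<gamma>_def sum_distrib_left mult_ac)
  qed
  \<comment> \<open>Cauchy-Schwarz over the finite set \<open>E\<close> leaves a finite sum of the
    square summable coordinate sequences of the vectors \<open>C e\<close>.\<close>
  have \<gamma>_summable: "summable (\<lambda>k. (\<gamma> k)\<^sup>2)"
  proof (rule summable_comparison_test')
    show "summable (\<lambda>k. (\<Sum>e\<in>E. (N e)\<^sup>2) * (\<Sum>e\<in>E. (cmod (coord (C e) k))\<^sup>2))"
      by (intro summable_mult summable_sum coord_square_summable)
    show "norm ((\<gamma> k)\<^sup>2) \<le> (\<Sum>e\<in>E. (N e)\<^sup>2) * (\<Sum>e\<in>E. (cmod (coord (C e) k))\<^sup>2)" for k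
      unfolding \<gamma>_def by (simp add: Cauchy_Schwarz_ineq_sum)
  qed
  let ?f = "\<lambda>u k s. coord (C (u s)) k"
  have f_Linf: "?f u k \<in> Linf" and f_norm: "Linf_norm (?f u k) \<le> \<gamma> k * Linf_norm u"
    if "u \<in> Linf" for u k
    using Linf_bounded_linear[OF that bounded_linear_compose[OF bounded_linear_coord bounded_clinearD[OF C]]
        coord_C \<open>\<gamma> k \<ge> 0\<close>] by auto
  let ?z = "\<lambda>t u k. (a - ev k) * exp_convolution (ev k) (?f u k) t"
  \<comment> \<open>The factor |Re (ev k)| lost in the sector estimate cancels the one gained by the
    convolution.\<close>
  have z_bound: "cmod (?z t u k) \<le> \<kappa> * \<gamma> k * Linf_norm u" if "u \<in> Linf" for t u k
  proof -
    have "cmod (?z t u k) \<le> (\<kappa> * \<bar>Re (ev k)\<bar>) * (\<gamma> k * Linf_norm u / \<bar>Re (ev k)\<bar>)"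
      unfolding norm_mult
    proof (rule mult_mono[OF sector])
      have "cmod (exp_convolution (ev k) (?f u k) t) \<le> Linf_norm (?f u k) / \<bar>Re (ev k)\<bar>"
        by (intro exp_convolution_bound f_Linf that Re_ev_neg)
      also have "\<dots> \<le> \<gamma> k * Linf_norm u / \<bar>Re (ev k)\<bar>"
        by (intro divide_right_mono f_norm that) simp
      finally show "cmod (exp_convolution (ev k) (?f u k) t) \<le> \<gamma> k * Linf_norm u / \<bar>Re (ev k)\<bar>" .
    qed (use \<open>\<kappa> \<ge> 0\<close> in auto)
    then show ?thesis using Re_ev_neg[of k] by simp
  qed
  have \<eta>: "summable (\<lambda>k. (\<kappa> * \<gamma> k * L)\<^sup>2)" for L
    using summable_mult[OF \<gamma>_summable, of "(\<kappa> * L)\<^sup>2"] by (simp add: power_mult_distrib mult_ac)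
  have z_sq: "(cmod (?z t u k))\<^sup>2 \<le> (\<kappa> * \<gamma> k * Linf_norm u)\<^sup>2" if "u \<in> Linf" for t u k
    by (intro power_mono z_bound that norm_ge_zero)
  have z_summable: "summable (\<lambda>k. (cmod (?z t u k))\<^sup>2)" if "u \<in> Linf" for t u
    using z_sq[OF that] by (intro summable_comparison_test'[OF \<eta>]) simp
  define z where "z t u = (\<Sum>k. scaleC (?z t u k) (\<phi> k))" for t u
  have coord_z: "coord (z t u) k = ?z t u k" if "u \<in> Linf" for t u k
    unfolding z_def by (simp add: coord_suminf[OF z_summable[OF that]])
  obtain c where "c > 0" and c: "\<And>b. summable (\<lambda>k. (cmod (b k))\<^sup>2) \<Longrightarrow>
      (norm (\<Sum>k. scaleC (b k) (\<phi> k)))\<^sup>2 \<le> c * (\<Sum>k. (cmod (b k))\<^sup>2)"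
    by (rule riesz_bounds) blast
  define K where "K = sqrt (c * (\<Sum>k. (\<kappa> * \<gamma> k)\<^sup>2))"
  have z_norm: "norm (z t u) \<le> K * Linf_norm u" if "u \<in> Linf" for t u
  proof (rule power2_le_imp_le)
    have nn: "(\<Sum>k. (\<kappa> * \<gamma> k)\<^sup>2) \<ge> 0"
      using \<eta>[of 1] by (intro suminf_nonneg) auto
    have "(norm (z t u))\<^sup>2 \<le> c * (\<Sum>k. (cmod (?z t u k))\<^sup>2)"
      unfolding z_def by (rule c[OF z_summable[OF that]])
    also have "\<dots> \<le> c * (\<Sum>k. (\<kappa> * \<gamma> k * Linf_norm u)\<^sup>2)"
      using \<open>c > 0\<close> z_sq[OF that]
      by (intro mult_left_mono suminf_le z_summable that \<eta>) auto
    also have "(\<Sum>k. (\<kappa> * \<gamma> k * Linf_norm u)\<^sup>2) = (\<Sum>k. (\<kappa> * \<gamma> k)\<^sup>2) * (Linf_norm u)\<^sup>2"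
      unfolding power_mult_distrib[of _ "Linf_norm u"] using \<eta>[of 1] by (intro suminf_mult2[symmetric]) simp
    also have "c * \<dots> = (K * Linf_norm u)\<^sup>2"
      using \<open>c > 0\<close> nn by (simp add: K_def power_mult_distrib)
    finally show "(norm (z t u))\<^sup>2 \<le> (K * Linf_norm u)\<^sup>2" .
    show "0 \<le> K * Linf_norm u"
      using \<open>c > 0\<close> nn LinfD(3)[OF that] by (simp add: K_def)
  qed
  have z_cont: "continuous_on {0..} (\<lambda>t. z t u)" if "u \<in> Linf" for u
  proof (rule continuous_on_coord[OF _ _ \<eta>])
    show "continuous_on {0..} (\<lambda>t. coord (z t u) k)" for k
      unfolding coord_z[OF that]
      by (intro continuous_intros exp_convolution_continuous f_Linf that)
    show "cmod (coord (z t u) k) \<le> \<kappa> * \<gamma> k * Linf_norm u" for t k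
      unfolding coord_z[OF that] by (rule z_bound[OF that])
  qed
  show ?thesis
  \<comment> \<open>\<open>K\<close> vanishes when C = 0, but the gain r |-> K r must be
    unbounded.\<close>
  proof (rule that[of "max 1 K" z])
    show "norm (z t u) \<le> max 1 K * Linf_norm u" if "u \<in> Linf" for t u
      by (rule order_trans[OF z_norm[OF that] mult_right_mono[OF _ LinfD(3)[OF that]]]) simp
  qed (auto simp: coord_z z_cont)
qed

text \<open>Coordinates separate points, so identity, causality and cocycle property are checked on
  scalar convolutions. The comparison functions are M exp (-\<omega> t) r and K r.\<close>

lemma ISS_variation_of_constants:
  fixes C :: "'u::cbanach \<Rightarrow> 'a"
  assumes "M > 0" "\<omega> > 0" and stable: "\<And>t x. t \<ge> 0 \<Longrightarrow> norm (T t x) \<le> M * exp (- \<omega> * t) * norm x"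
    and C: "bounded_clinear C" and "K > 0"
    and coord_z: "\<And>t u k. u \<in> Linf \<Longrightarrow>
      coord (z t u) k = (a - ev k) * exp_convolution (ev k) (\<lambda>s. coord (C (u s)) k) t"
    and z_norm: "\<And>t u. u \<in> Linf \<Longrightarrow> norm (z t u) \<le> K * Linf_norm u"
    and z_cont: "\<And>u. u \<in> Linf \<Longrightarrow> continuous_on {0..} (\<lambda>t. z t u)"
  shows "ISS Linf Linf_norm (\<lambda>t x u. T t x + z t u)"
proof -
  have lin: "bounded_linear (\<lambda>u. coord (C u) k)" for k
    by (intro bounded_linear_compose[OF bounded_linear_coord] bounded_clinearD C)
  have f_Linf: "(\<lambda>s. coord (C (u s)) k) \<in> Linf" if u: "u \<in> Linf" for u :: "real \<Rightarrow> 'u" and k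
  proof -
    obtain B where "B \<ge> 0" and "\<And>x. cmod (coord (C x) k) \<le> norm x * B"
      using bounded_linear.nonneg_bounded[OF lin[of k]] by blast
    then show ?thesis
      by (intro Linf_bounded_linear(1)[OF u lin, where K=B]) (auto simp: mult.commute)
  qed
  have "forward_complete_control_system Linf Linf_norm (\<lambda>t x u. T t x + z t u)"
    unfolding forward_complete_control_system_def
  proof (intro conjI allI ballI impI)
    fix u v :: "real \<Rightarrow> 'u" and t h :: real and x :: 'a
    assume u: "u \<in> Linf"
    show "(\<lambda>s. u (t + s)) \<in> Linf" "Linf_norm (\<lambda>s. u (t + s)) \<le> Linf_norm u" if "t \<ge> 0"
      using Linf_shift[OF u that] by auto
    show "(\<lambda>s. if s \<le> t then u s else v (s - t)) \<in> Linf" if "v \<in> Linf" "t > 0"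
      by (intro Linf_concat u that)
    show "T 0 x + z 0 u = x"
    proof -
      have "coord (z 0 u) k = coord 0 k" for k
      proof -
        have "coord (z 0 u) k = 0"
          by (simp add: coord_z[OF u] exp_convolution_eq_integral[OF f_Linf[OF u]])
        moreover have "coord 0 k = 0" using coord_scaleC[of 0 0 k] by simp
        ultimately show ?thesis by simp
      qed
      then have "z 0 u = 0" by (rule eq_if_coord_eq)
      then show ?thesis by (simp add: C0_semigroupD(2)[OF T])
    qed
    show "T t x + z t u = T t x + z t v" if "v \<in> Linf" "AE s in lebesgue_on {0..t}. u s = v s"
    proof -
      have "AE s in lebesgue_on {0..t}. coord (C (u s)) k = coord (C (v s)) k" for k
        using that(2) by eventually_elim simp
      then have "coord (z t u) k = coord (z t v) k" for k
        using exp_convolution_cong_AE[OF f_Linf[OF u] f_Linf[OF that(1)]]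
        by (simp add: coord_z u that(1))
      then show ?thesis using eq_if_coord_eq[of "z t u" "z t v"] by simp
    qed
    show "continuous_on {0..} (\<lambda>t. T t x + z t u)"
      by (intro continuous_on_add continuous_orbit z_cont u)
    show "T h (T t x + z t u) + z h (\<lambda>s. u (t + s)) = T (t + h) x + z (t + h) u"
      if "t \<ge> 0" "h \<ge> 0"
    proof (rule eq_if_coord_eq)
      fix k
      have "exp_convolution (ev k) (\<lambda>s. coord (C (u s)) k) (t + h) =
          exp (ev k * complex_of_real h) * exp_convolution (ev k) (\<lambda>s. coord (C (u s)) k) t +
          exp_convolution (ev k) (\<lambda>s. coord (C (u (t + s))) k) h"
        by (rule exp_convolution_cocycle[OF f_Linf[OF u] that])
      moreover have "exp (ev k * complex_of_real (t + h)) =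
          exp (ev k * complex_of_real h) * exp (ev k * complex_of_real t)"
        by (simp add: algebra_simps flip: exp_add)
      ultimately show "coord (T h (T t x + z t u) + z h (\<lambda>s. u (t + s))) k = coord (T (t + h) x + z (t + h) u) k"
        using that by (simp add: coord_add coord_T coord_z[OF u] coord_z[OF Linf_shift(1)[OF u \<open>t \<ge> 0\<close>]]
            distrib_left distrib_right mult_ac del: of_real_add)
    qed
  qed
  moreover have "class_KL (\<lambda>r t. M * exp (- \<omega> * t) * r)"
    unfolding class_KL_def
  proof (intro conjI allI impI)
    show "continuous_on ({0..} \<times> {0..}) (\<lambda>(r, t). M * exp (- \<omega> * t) * r)"
      unfolding case_prod_unfold by (intro continuous_intros)
    show "strict_mono_on {0..} (\<lambda>r. M * exp (- \<omega> * t) * r)" for t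
      using \<open>M > 0\<close> by (auto simp: strict_mono_on_def)
    fix r :: real assume "r > 0"
    show "strict_antimono_on {0..} (\<lambda>t. M * exp (- \<omega> * t) * r)"
      using \<open>M > 0\<close> \<open>\<omega> > 0\<close> \<open>r > 0\<close> by (auto simp: monotone_on_def)
    have "filterlim (\<lambda>t. - \<omega> * t) at_bot at_top"
      using \<open>\<omega> > 0\<close>
      by (intro filterlim_tendsto_neg_mult_at_bot[OF tendsto_const] filterlim_ident) auto
    then have "((\<lambda>t. M * exp (- \<omega> * t) * r) \<longlongrightarrow> M * 0 * r) at_top"
      by (intro tendsto_intros filterlim_compose[OF exp_at_bot])
    then show "((\<lambda>t. M * exp (- \<omega> * t) * r) \<longlongrightarrow> 0) at_top" by simp
  qed simp
  moreover have "class_Kinf (\<lambda>r. K * r)"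
    unfolding class_Kinf_def
  proof (intro conjI allI)
    show "\<exists>r\<ge>0. m < K * r" for m
      using \<open>K > 0\<close> by (intro exI[of _ "(\<bar>m\<bar> + 1) / K"]) auto
  qed (use \<open>K > 0\<close> in \<open>auto simp: strict_mono_on_def intro!: continuous_intros\<close>)
  moreover have "norm (T t x + z t u) \<le> M * exp (- \<omega> * t) * norm x + K * Linf_norm u"
    if "u \<in> Linf" "t \<ge> 0" for t x u
    by (rule norm_triangle_le) (intro add_mono stable z_norm that)
  ultimately show ?thesis
    unfolding ISS_def by blast
qed

end

section \<open>Stable analytic semigroups with a Riesz basis of eigenvectors\<close>

lemma exponentially_stable_bound:
  assumes "C0_semigroup T" and "exponentially_stable T"
  obtains M \<omega> where "M > 0" and "\<omega> > 0"
    and "\<And>t x. t \<ge> 0 \<Longrightarrow> norm (T t x) \<le> M * exp (- \<omega> * t) * norm x"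
proof -
  obtain M \<omega> where "M > 0" "\<omega> > 0" and M: "\<And>t. t \<ge> 0 \<Longrightarrow> onorm (T t) \<le> M * exp (- \<omega> * t)"
    using assms(2) unfolding exponentially_stable_def by blast
  have "norm (T t x) \<le> M * exp (- \<omega> * t) * norm x" if "t \<ge> 0" for t x
    using onorm[OF bounded_clinearD[OF C0_semigroupD(1)[OF assms(1) that]], of x]
      mult_right_mono[OF M[OF that] norm_ge_zero[of x]] by linarith
  then show ?thesis using \<open>M > 0\<close> \<open>\<omega> > 0\<close> by (rule that[rotated 2])
qed

text \<open>Analyticity bounds |Im (ev n)| only up to an additive constant. As the decay rate gives
  |Re (ev n)| >= \<omega>, every constant b is at most (b / \<omega>) |Re (ev n)|, and the bound
  becomes multiplicative.\<close>

lemma stable_analytic_diagonal: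
  assumes basis: "riesz_basis \<phi>"
    and gen: "generates D A T" and stable: "exponentially_stable T" and analytic: "analytic_semigroup T"
    and eig: "\<And>n. \<phi> n \<in> D" "\<And>n. \<phi> n \<noteq> 0" "\<And>n. A (\<phi> n) = scaleC (ev n) (\<phi> n)"
  shows "diagonal_semigroup \<phi> T ev"
    and "\<exists>\<kappa>\<ge>0. \<forall>n. cmod (a - ev n) \<le> \<kappa> * \<bar>Re (ev n)\<bar>"
proof -
  interpret riesz_basis \<phi> by (rule basis)
  have T: "C0_semigroup T" using gen by (simp add: generates_def)
  obtain M \<omega> where "M > 0" "\<omega> > 0"
    and M: "\<And>t x. t \<ge> 0 \<Longrightarrow> norm (T t x) \<le> M * exp (- \<omega> * t) * norm x"
    using exponentially_stable_bound[OF T stable] by blast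
  have M': "norm (T t x) \<le> M * norm x" if "t \<ge> 0" for t x
  proof -
    have "M * exp (- \<omega> * t) * norm x \<le> M * 1 * norm x"
      using \<open>M > 0\<close> \<open>\<omega> > 0\<close> that by (intro mult_mono) auto
    with M[OF that, of x] show ?thesis by simp
  qed
  have T\<phi>: "T t (\<phi> n) = scaleC (exp (ev n * complex_of_real t)) (\<phi> n)" if "t \<ge> 0" for t n
    using generates_tendsto[OF gen eig(1)[of n]] that
    by (intro semigroup_eigenvector[OF T M']) (simp_all add: eig(3))
  have Re: "Re (ev n) \<le> - \<omega>" for n
  proof (rule exponential_growth_exponent_le[OF \<open>M > 0\<close>])
    fix t :: real assume "t \<ge> 0"
    from M[OF this, of "\<phi> n"] show "exp (Re (ev n) * t) \<le> M * exp (- \<omega> * t)"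
      using eig(2)[of n] by (simp add: T\<phi>[OF \<open>t \<ge> 0\<close>] norm_scaleC norm_exp_eq_Re)
  qed
  have "Re (ev n) < 0" for n using Re[of n] \<open>\<omega> > 0\<close> by linarith
  then show "diagonal_semigroup \<phi> T ev"
    by unfold_locales (simp_all add: T T\<phi>)
  obtain r K where "r > 0" and rK: "\<And>x \<mu>. x \<noteq> 0 \<Longrightarrow>
      (\<And>t. t \<ge> 0 \<Longrightarrow> T t x = scaleC (exp (\<mu> * complex_of_real t)) x) \<Longrightarrow> r * \<bar>Im \<mu>\<bar> \<le> K - Re \<mu>"
    using analytic_semigroup_eigenvalue_bound[OF analytic] by blast
  \<comment> \<open>The three summands account for |a|, for the real part of \<open>ev n\<close> and
    for its imaginary part.\<close>
  define \<kappa> where "\<kappa> = cmod a / \<omega> + 1 + (\<bar>K\<bar> / \<omega> + 1) / r"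
  have "cmod (a - ev n) \<le> \<kappa> * \<bar>Re (ev n)\<bar>" for n
  proof -
    let ?m = "\<bar>Re (ev n)\<bar>"
    have "\<omega> \<le> ?m" using Re[of n] by simp
    then have le: "b \<le> b / \<omega> * ?m" if "b \<ge> 0" for b
      using mult_left_mono[OF \<open>\<omega> \<le> ?m\<close> that] \<open>\<omega> > 0\<close> by (simp add: field_simps)
    have "r * \<bar>Im (ev n)\<bar> \<le> \<bar>K\<bar> + ?m"
      using rK[OF eig(2) T\<phi>, of n] by linarith
    also have "\<dots> \<le> (\<bar>K\<bar> / \<omega> + 1) * ?m" using le[of "\<bar>K\<bar>"] by (simp add: algebra_simps)
    finally have im: "\<bar>Im (ev n)\<bar> \<le> (\<bar>K\<bar> / \<omega> + 1) / r * ?m"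
      using \<open>r > 0\<close> by (simp add: field_simps)
    have "cmod (a - ev n) \<le> cmod a + (?m + \<bar>Im (ev n)\<bar>)"
      by (intro order_trans[OF norm_triangle_ineq4] add_left_mono cmod_le)
    also have "\<dots> \<le> cmod a / \<omega> * ?m + (?m + (\<bar>K\<bar> / \<omega> + 1) / r * ?m)"
      by (intro add_mono im le) auto
    finally show ?thesis by (simp add: \<kappa>_def algebra_simps)
  qed
  moreover have "\<kappa> \<ge> 0" using \<open>\<omega> > 0\<close> \<open>r > 0\<close> by (simp add: \<kappa>_def)
  ultimately show "\<exists>\<kappa>\<ge>0. \<forall>n. cmod (a - ev n) \<le> \<kappa> * \<bar>Re (ev n)\<bar>" by blast
qed

text \<open>Expanding the input in a basis of U turns the integrand into a finite sum of scalar
  inputs times continuous orbits of the fixed vectors \<open>B e\<close>; joint measurability of (t,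
  y) |-> \<open>Tm t y\<close> never has to be discussed.\<close>

lemma finite_dim_convolution_integrable:
  fixes B :: "'u::cbanach \<Rightarrow> 'y::{cbanach, second_countable_topology}"
  assumes fin_dim: "finite_dim_space TYPE('u)" and B: "bounded_clinear B"
    and Tm: "C0_semigroup Tm" and cont: "\<And>y. continuous_on {0..} (\<lambda>t. Tm t y)"
    and u: "u \<in> Linf"
  shows "convolution_integrable Tm B t u"
proof -
  obtain E :: "'u set" and p where "finite E" and p: "\<And>e. e \<in> E \<Longrightarrow> bounded_linear (p e)"
    and sum_p: "\<And>u. u = (\<Sum>e\<in>E. scaleC (p e u) e)"
    using finite_dim_coordinates[OF fin_dim] by blast
  have p_Linf: "(\<lambda>s. p e (u s)) \<in> Linf" if e: "e \<in> E" for e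
  proof -
    obtain N where "N \<ge> 0" "\<And>x. cmod (p e x) \<le> norm x * N"
      using bounded_linear.nonneg_bounded[OF p[OF e]] by blast
    then show ?thesis
      by (intro Linf_bounded_linear(1)[OF u p[OF e], where K=N]) (auto simp: mult.commute)
  qed
  have scaleC: "bounded_bilinear (scaleC :: complex \<Rightarrow> 'y \<Rightarrow> 'y)"
    by (rule bounded_bilinear.intro)
       (auto simp: scaleC_add_left scaleC_add_right scaleC_scaleR_commute scaleR_scaleC scaleC_scaleC
          norm_scaleC scaleR_conv_of_real mult.commute intro!: exI[of _ 1])
  have "set_integrable lebesgue {0..t} (\<lambda>s. scaleC (p e (u s)) (Tm (t - s) (B e)))" if "e \<in> E" for e
    by (rule Linf_set_integrable[OF scaleC p_Linf[OF that]])
       (rule continuous_on_compose2[OF cont], auto intro!: continuous_intros)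
  then have "set_integrable lebesgue {0..t} (\<lambda>s. \<Sum>e\<in>E. scaleC (p e (u s)) (Tm (t - s) (B e)))"
    unfolding set_integrable_def scaleR_sum_right by (intro Bochner_Integration.integrable_sum)
  moreover have "(\<Sum>e\<in>E. scaleC (p e (u s)) (Tm (t - s) (B e))) = Tm (t - s) (B (u s))"
    if "s \<in> {0..t}" for s
  proof -
    have Tm': "bounded_clinear (Tm (t - s))" using that by (intro C0_semigroupD(1)[OF Tm]) simp
    have "linear (\<lambda>u. Tm (t - s) (B u))"
      using bounded_linear_compose[OF bounded_clinearD[OF Tm'] bounded_clinearD[OF B]]
      by (rule bounded_linear.linear)
    then have "Tm (t - s) (B (u s)) = (\<Sum>e\<in>E. Tm (t - s) (B (scaleC (p e (u s)) e)))"
      by (subst sum_p[of "u s"]) (rule linear_sum)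
    then show ?thesis by (simp add: bounded_clinear_scaleC[OF B] bounded_clinear_scaleC[OF Tm'])
  qed
  ultimately show ?thesis
    unfolding convolution_integrable_def by (subst (asm) set_integrable_cong[OF refl refl]) auto
qed

theorem proposition4p11:
  fixes DA DG :: "'x::chilbert_space set"
    and Ah :: "'x \<Rightarrow> 'x" and Gh :: "'x \<Rightarrow> 'u::cbanach"
    and G :: "'u \<Rightarrow> 'x"
    and T :: "real \<Rightarrow> 'x \<Rightarrow> 'x"
    and a :: complex
    and j :: "'x \<Rightarrow> 'y::{cbanach, second_countable_topology}"
    and Tm :: "real \<Rightarrow> 'y \<Rightarrow> 'y"
  assumes separable: "separable_space (euclidean :: 'x topology)"
    and bcs: "boundary_control_system DA Ah DG Gh T G"
    and riesz: "riesz_spectral (bcs_domain DA Gh) Ah"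
    and stable: "exponentially_stable T"
    and analytic: "analytic_semigroup T"
    and fin_dim: "finite_dim_space TYPE('u)"
    and X_minus_1: "extrapolation_space a (bcs_domain DA Gh) Ah j"
    and T_minus_1: "extrapolated_semigroup j T Tm"
  shows "infty_admissible j Tm (bcs_input_operator j Tm Ah G) \<and>
    (\<exists>\<phi>. bcs_mild_solution_map j T Tm Ah G \<phi> \<and> ISS Linf Linf_norm \<phi>) \<and>
    (\<exists>\<phi>. mild_solution_map j T Tm (bcs_input_operator j Tm Ah G) \<phi> \<and> ISS Linf Linf_norm \<phi>)"
proof -
  let ?D = "bcs_domain DA Gh" and ?B = "bcs_input_operator j Tm Ah G"
  let ?R = "resolvent ?D Ah a"
  have gen: "generates ?D Ah T" and G: "bounded_clinear G" and AG: "bounded_clinear (\<lambda>u. Ah (G u))"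
    using bcs by (auto simp: boundary_control_system_def lifting_operator_def)
  have T: "C0_semigroup T" using gen by (simp add: generates_def)
  have a: "a \<in> resolvent_set ?D Ah"
    and j_add: "\<And>x y. j (x + y) = j x + j y" and dense_j: "closure (range j) = UNIV"
    using X_minus_1 unfolding extrapolation_space_def linear_scaleC_iff by auto
  note R = resolvent_apply[OF a]
  have Tm: "C0_semigroup Tm" and Tmj: "\<And>t x. t \<ge> 0 \<Longrightarrow> Tm t (j x) = j (T t x)"
    using T_minus_1 by (auto simp: extrapolated_semigroup_def)
  obtain ev \<phi> where \<phi>: "\<And>n. \<phi> n \<in> ?D" "\<And>n. \<phi> n \<noteq> 0" "\<And>n. Ah (\<phi> n) = scaleC (ev n) (\<phi> n)"
    and "riesz_basis2 \<phi>"
    using riesz unfolding riesz_spectral_def by blast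
  then have basis: "riesz_basis \<phi>" by (simp add: riesz_basis_def)
  interpret diagonal_semigroup \<phi> T ev
    by (rule stable_analytic_diagonal(1)[OF basis gen stable analytic \<phi>])
  obtain \<kappa> where "\<kappa> \<ge> 0" and \<kappa>: "\<And>n. cmod (a - ev n) \<le> \<kappa> * \<bar>Re (ev n)\<bar>"
    using stable_analytic_diagonal(2)[OF basis gen stable analytic \<phi>] by blast
  obtain M \<omega> where M: "M > 0" "\<omega> > 0" "\<And>t x. t \<ge> 0 \<Longrightarrow> norm (T t x) \<le> M * exp (- \<omega> * t) * norm x"
    using exponentially_stable_bound[OF T stable] by blast

  have R\<phi>': "scaleC (a - ev n) (?R (\<phi> n)) = \<phi> n" for n
    using R(4)[OF \<phi>(1), of n] by (simp add: \<phi>(3) bounded_clinear_scaleC[OF R(3)] flip: scaleC_diff_left)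
  \<comment> \<open>Otherwise the preceding equation would make the eigenvector zero.\<close>
  have a_ev: "a - ev n \<noteq> 0" for n
    using R\<phi>'[of n] \<phi>(2)[of n] by auto
  have R\<phi>: "?R (\<phi> n) = scaleC (inverse (a - ev n)) (\<phi> n)" for n
  proof -
    have "scaleC (inverse (a - ev n)) (\<phi> n) = scaleC (inverse (a - ev n) * (a - ev n)) (?R (\<phi> n))"
      by (simp only: R\<phi>' flip: scaleC_scaleC)
    then show ?thesis by (simp only: left_inverse[OF a_ev] scaleC_one)
  qed
  have coord_R: "coord (?R x) n = inverse (a - ev n) * coord x n" for x n
    by (rule coord_diagonal[OF R(3) R\<phi>])
  have R_T: "?R (T t x) = T t (?R x)" if "t \<ge> 0" for t x
    by (rule eq_if_coord_eq) (simp add: coord_R coord_T that)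
  \<comment> \<open>This is density of D(A): the range of the resolvent contains all basis
    vectors.\<close>
  have "closure (range ?R) = UNIV"
  proof (rule closed_subspace_eq_UNIV)
    interpret vector_space "scaleC :: complex \<Rightarrow> 'x \<Rightarrow> 'x" by (rule vector_space_scaleC)
    have sub: "x + y \<in> closure (range ?R)" "scaleC c x \<in> closure (range ?R)"
      if "x \<in> closure (range ?R)" "y \<in> closure (range ?R)" for x y c
    proof -
      obtain f g where f: "\<And>n. f n \<in> range ?R" "f \<longlonglongrightarrow> x" and g: "\<And>n. g n \<in> range ?R" "g \<longlonglongrightarrow> y"
        using \<open>x \<in> _\<close> \<open>y \<in> _\<close> unfolding closure_sequential by blast
      have "f n + g n \<in> range ?R" "scaleC c (f n) \<in> range ?R" for n
        using f(1)[of n] g(1)[of n] R(3)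
        by (auto simp: bounded_clinear_iff linear_simps(1)[symmetric] simp del: linear_simps)
           (metis rangeI)+
      then show "x + y \<in> closure (range ?R)" "scaleC c x \<in> closure (range ?R)"
        unfolding closure_sequential
        using tendsto_add[OF f(2) g(2)] bounded_linear.tendsto[OF bounded_linear_scaleC_right f(2), of c]
        by (auto intro: exI[of _ "\<lambda>n. f n + g n"] exI[of _ "\<lambda>n. scaleC c (f n)"])
    qed
    have "\<phi> n \<in> range ?R" for n
      by (metis R\<phi>' bounded_clinear_scaleC[OF R(3)] rangeI)
    then show "\<phi> n \<in> closure (range ?R)" for n using closure_subset by blast
    then show "module.subspace scaleC (closure (range ?R))"
      unfolding subspace_def using sub scaleC_zero_left by metis
  qed simp
  then obtain J :: "'y \<Rightarrow> 'x" where J: "bounded_clinear J" and norm_J: "\<And>y. norm (J y) = norm y"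
    and Jj: "\<And>x. J (j x) = ?R x" and "surj J"
    using extrapolation_isometry[OF X_minus_1] by blast
  have J_lin: "bounded_linear J" by (rule bounded_clinearD[OF J])
  have J_inj: "y = z" if "J y = J z" for y z
    using norm_J[of "y - z"] that J_lin by (simp add: linear_simps)
  \<comment> \<open>On the range of \<open>j\<close> this says that the resolvent commutes with
    \<open>T t\<close>, both being diagonal. The set where it holds is closed.\<close>
  have J_Tm: "J (Tm t y) = T t (J y)" if "t \<ge> 0" for t y
  proof -
    have "closed {y. J (Tm t y) = T t (J y)}"
      using C0_semigroupD(1)[OF T that] C0_semigroupD(1)[OF Tm that]
      by (intro closed_Collect_eq linear_continuous_on bounded_linear_compose[OF J_lin]
          bounded_linear_compose[OF _ J_lin] bounded_clinearD)
    moreover have "range j \<subseteq> {y. J (Tm t y) = T t (J y)}"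
      using that by (auto simp: Tmj Jj R_T)
    ultimately have "closure (range j) \<subseteq> {y. J (Tm t y) = T t (J y)}" by (rule closure_minimal[rotated])
    then show ?thesis by (auto simp: dense_j)
  qed
  have cont_Tm: "continuous_on {0..} (\<lambda>t. Tm t y)" for y
  proof -
    have "dist (Tm t y) (Tm s y) = dist (T t (J y)) (T s (J y))" if "t \<in> {0..}" "s \<in> {0..}" for s t
      unfolding dist_norm using that J_lin
      by (subst norm_J[symmetric]) (simp add: linear_simps J_Tm)
    then show ?thesis
      using continuous_orbit[of "J y"] by (simp add: continuous_on_iff)
  qed

  define C where "C u = J (?B u)" for u
  \<comment> \<open>The last bracket is A R G u, with R the resolvent, rewritten as a R G u - G u.
    No unbounded operator acts outside the bounded composition of \<open>Ah\<close> and
    \<open>G\<close>, so boundedness of \<open>C\<close> can be read off.\<close>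
  have C_eq: "C u = ?R (Ah (G u)) - (scaleC a (?R (G u)) - G u)" for u
  proof -
    have "J (gen Tm (j (G u))) = Ah (J (j (G u)))"
      by (rule gen_extrapolated[OF J_lin norm_J \<open>surj J\<close> J_Tm gen]) (simp_all add: Jj R(1))
    then show ?thesis
      using J_lin by (simp add: C_def bcs_input_operator_def linear_simps Jj R(2))
  qed
  have C: "bounded_clinear C"
    unfolding bounded_clinear_iff
  proof (intro conjI allI)
    show "bounded_linear C"
      unfolding C_eq[abs_def]
      by (intro bounded_linear_sub bounded_linear_compose[OF bounded_clinearD[OF R(3)]]
          bounded_linear_compose[OF bounded_linear_scaleC_right] bounded_clinearD AG G)
    show "C (scaleC c u) = scaleC c (C u)" for c u
      unfolding C_eq bounded_clinear_scaleC[OF AG]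
      by (simp add: bounded_clinear_scaleC[OF R(3)] bounded_clinear_scaleC[OF G]
          scaleC_diff_right scaleC_scaleC mult.commute)
  qed
  \<comment> \<open>Pulled back from \<open>C\<close> through \<open>J\<close>: linearity by
    injectivity, the bound by isometry.\<close>
  have B: "bounded_clinear ?B"
    unfolding bounded_clinear_def linear_scaleC_iff
  proof (intro conjI allI)
    show "?B (u + v) = ?B u + ?B v" for u v
      using J_lin bounded_clinearD[OF C]
      by (intro J_inj) (simp add: linear_simps flip: C_def)
    show "?B (scaleC c u) = scaleC c (?B u)" for c u
      by (intro J_inj) (simp add: bounded_clinear_scaleC[OF J] bounded_clinear_scaleC[OF C] flip: C_def)
    obtain K where "\<forall>u. norm (C u) \<le> norm u * K"
      using bounded_linear.bounded[OF bounded_clinearD[OF C]] by blast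
    then have "norm (?B u) \<le> K * norm u" for u
      by (metis C_def norm_J mult.commute)
    then show "\<exists>K. \<forall>u. norm (?B u) \<le> K * norm u" by blast
  qed
  obtain z K where "K > 0" and coord_z: "\<And>t u k. u \<in> Linf \<Longrightarrow>
      coord (z t u) k = (a - ev k) * exp_convolution (ev k) (\<lambda>s. coord (C (u s)) k) t"
    and z_norm: "\<And>t u. u \<in> Linf \<Longrightarrow> norm (z t u) \<le> K * Linf_norm u"
    and z_cont: "\<And>u. u \<in> Linf \<Longrightarrow> continuous_on {0..} (\<lambda>t. z t u)"
    by (rule reachable_states[OF fin_dim C \<kappa> \<open>\<kappa> \<ge> 0\<close>]) (rule that)
  have integrable: "convolution_integrable Tm ?B t u" if "u \<in> Linf" for t u
    by (rule finite_dim_convolution_integrable[OF fin_dim B Tm cont_Tm that])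
  \<comment> \<open>A bounded functional may be moved inside the Bochner integral, which becomes
    scalar. On the other side \<open>J\<close> acts on \<open>j (z t u)\<close> as the resolvent and
    cancels the factor a - ev k built into \<open>z\<close>.\<close>
  have conv: "input_convolution Tm ?B t u = j (z t u)" if "u \<in> Linf" for t u
  proof (intro J_inj eq_if_coord_eq)
    fix k
    have lin: "bounded_linear (\<lambda>y. coord (J y) k)"
      by (rule bounded_linear_compose[OF bounded_linear_coord J_lin])
    have "coord (J (input_convolution Tm ?B t u)) k =
        (LINT s|lebesgue. coord (J (indicator {0..t} s *\<^sub>R Tm (t - s) (?B (u s)))) k)"
      using integrable[OF that, of t]
      unfolding input_convolution_def set_lebesgue_integral_def convolution_integrable_def set_integrable_def
      by (rule integral_bounded_linear[OF lin, symmetric])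
    also have "\<dots> = exp_convolution (ev k) (\<lambda>s. coord (C (u s)) k) t"
      unfolding exp_convolution_def set_lebesgue_integral_def
    proof (rule Bochner_Integration.integral_cong[OF refl])
      fix s
      show "coord (J (indicat_real {0..t} s *\<^sub>R Tm (t - s) (?B (u s)))) k =
          indicat_real {0..t} s *\<^sub>R (coord (C (u s)) k * exp (ev k * complex_of_real (t - s)))"
        using linear_0[OF bounded_linear.linear[OF lin]]
        by (auto simp: indicator_def J_Tm coord_T C_def mult.commute)
    qed
    also have "\<dots> = coord (J (j (z t u))) k"
      using a_ev[of k] by (simp add: Jj coord_R coord_z[OF that])
    finally show "coord (J (input_convolution Tm ?B t u)) k = coord (J (j (z t u))) k" .
  qed
  let ?sol = "\<lambda>t x u. T t x + z t u"
  have ISS: "ISS Linf Linf_norm ?sol"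
    by (rule ISS_variation_of_constants[OF M C \<open>K > 0\<close> coord_z z_norm z_cont])
  have mild: "mild_solution_map j T Tm ?B ?sol"
    by (simp add: mild_solution_map_def integrable conv j_add)
  \<comment> \<open>Both systems have the same variation-of-constants formula, so one solution map
    serves both.\<close>
  then have "bcs_mild_solution_map j T Tm Ah G ?sol"
    by (simp add: mild_solution_map_def bcs_mild_solution_map_def convolution_integrable_def
        input_convolution_def bcs_input_operator_def)
  moreover have "infty_admissible j Tm ?B"
    \<comment> \<open>The time 1 is arbitrary, since \<open>conv\<close> holds for every
      \<open>t\<close>.\<close>
    unfolding infty_admissible_def using B integrable conv by (intro conjI exI[of _ 1]) auto
  ultimately show ?thesis using ISS mild by blast
qed

end
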